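(* Let $\mathcal N(n)$ denote the number of representations of the positive integer $n$ in base $2$ with digits in $\{0,1,2\}$, and let $\alpha_0>0$ be the constant for which there exists a set $S\subset\mathbb N$ of natural density $1$ such that $$\lim_{n\in S,\ n\to\infty}\frac{\log\mathcal N(n)}{\log n}=\alpha_0.$$ Then $\alpha_0$ is also the Lebesgue-a.e. value, for $t\in\big[\frac12,1\big)$, of $$\lim_{s\to\infty}\frac{\log q_s(x(t))}{s\log4},$$ where $x(t)=[0;a_1,a_2,\dots]$ for any $t$ with binary expansion $t=0.1^{a_1}0^{a_2}1^{a_3}\dots$ in $\big[\frac12,1\big)$.
   Context: $\mathcal N(n)=\#\{(\omega_i)_{i\ge0}: n=\sum_{i\ge0}\omega_i2^i,\ \omega_i\in\{0,1,2\}\}$. The existence of $\alpha_0>0$ and of such a set $S$ (i.e. $\lim_{N\to\infty}\#(S\cap[1,N))/N=1$) is a known result, taken as given. The limit along $S=\{n_1<n_2<\dots\}$ means the limit along the sequence $(n_k)_k$. For $t\in[\frac12,1)$ whose binary expansion is neither eventually $0$ nor eventually $1$ (Lebesgue-almost every $t$), the expansion is written uniquely as a block of $a_1\ge1$ ones, then $a_2\ge1$ zeros, then $a_3\ge1$ ones, and so on. $[0;a_1,a_2,\dots]$ is the regular continued fraction $\cfrac{1}{a_1+\cfrac{1}{a_2+\cdots}}$ and $q_s(x(t))$ is the denominator of the (reduced) convergent $[0;a_1,\dots,a_s]$. *)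

theory Defs
  imports "HOL-Analysis.Analysis" "HOL-Library.Infinite_Set"
begin

text \<open>
  On \<^typ>\<open>nat\<close> the topology is discrete, so \<open>sums\<close> forces all but finitely many digits to vanish.
\<close>

definition hyperbinary_count :: "nat \<Rightarrow> nat" where
  "hyperbinary_count n =
     card {\<omega> :: nat \<Rightarrow> nat. (\<forall>i. \<omega> i \<in> {0, 1, 2}) \<and> (\<lambda>i. \<omega> i * 2 ^ i) sums n}"

definition has_natural_density :: "nat set \<Rightarrow> real \<Rightarrow> bool" where
  "has_natural_density S d \<longleftrightarrow>
     (\<lambda>N. real (card (S \<inter> {1..<N})) / real N) \<longlonglongrightarrow> d"

text \<open>
  Sequences of block lengths are indexed from \<open>0\<close>: \<open>a j\<close> is the length \<open>a\<^sub>j\<^sub>+\<^sub>1\<close> of the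
  block with number \<open>j + 1\<close>, which consists of ones exactly if \<open>j\<close> is even.  Likewise
  \<open>block_digit a i\<close> is the digit with weight \<open>1 / 2 ^ (i + 1)\<close> in \<open>0.1\<^bsup>a 0\<^esup>0\<^bsup>a 1\<^esup>1\<^bsup>a 2\<^esup>\<dots>\<close>.
\<close>

definition block_digit :: "(nat \<Rightarrow> nat) \<Rightarrow> nat \<Rightarrow> nat" where
  "block_digit a i =
     (if \<exists>j. even j \<and> (\<Sum>l<j. a l) \<le> i \<and> i < (\<Sum>l<Suc j. a l) then 1 else 0)"

definition block_expansion :: "real \<Rightarrow> (nat \<Rightarrow> nat) \<Rightarrow> bool" where
  "block_expansion t a \<longleftrightarrow>
     (\<forall>j. a j \<ge> 1) \<and> (\<lambda>i. real (block_digit a i) / 2 ^ Suc i) sums t"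

text \<open>\<open>cfrac [a\<^sub>1, \<dots>, a\<^sub>s]\<close> is the finite continued fraction \<open>[0; a\<^sub>1, \<dots>, a\<^sub>s]\<close>.\<close>

fun cfrac :: "nat list \<Rightarrow> rat" where
  "cfrac [] = 0"
| "cfrac (a # as) = 1 / (of_nat a + cfrac as)"

text \<open>\<^const>\<open>quotient_of\<close> yields the reduced fraction with positive denominator.\<close>

definition convergent_denom :: "(nat \<Rightarrow> nat) \<Rightarrow> nat \<Rightarrow> int" where
  "convergent_denom a s = snd (quotient_of (cfrac (map a [0..<s])))"

end

theory Submission
  imports Defs "HOL-Real_Asymp.Real_Asymp"
begin

text \<open>
  Write \<open>N n\<close> for the number of hyperbinary representations of \<open>n\<close>.  When the binary digits of
  \<open>n\<close> are read from the most significant one on, each digit acts on the pair \<open>(N n, N (n - 1))\<close>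
  by one of the two elementary matrices with a single off-diagonal 1 (lemma \<open>fold_step_bits\<close>).  So,
  up to a factor of order \<open>log n\<close>, \<open>N n\<close> is the norm \<open>norm1 w\<close> of the product of matrices
  belonging to the word \<open>w\<close> of the binary digits of \<open>n\<close> after the leading 1.  For a word
  \<open>1\<^sup>a0\<^sup>b1\<^sup>c\<dots>\<close> the same product is, up to interchanges of the coordinates, a product of
  continued fraction matrices, so that its norm is the continuant of \<open>(a, b, c, \<dots>)\<close>
  up to a factor 4 (lemma \<open>norm1_blocks_bounds\<close>).  Both constants of the theorem therefore
  measure the growth of \<open>norm1\<close> along random binary words: one in the mean over all words of
  a given length, the other along the digits of almost every \<open>t\<close>.

  The two agree because \<open>log norm1\<close> is additive under concatenation \<open>u @ v\<close> up to
  an error that is logarithmic in the length of \<open>v\<close>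
  (lemmas \<open>mass_submult\<close> and \<open>mass_supermult\<close>).  Cut the digits of \<open>t\<close> into blocks of a fixed
  length \<open>L\<close>.  By the strong law of large numbers for the digits of \<open>t\<close> in base \<open>2\<^sup>L\<close>
  (\<open>AE_digit_average\<close>), the growth rate per digit is almost surely within \<open>O(log L / L)\<close> of
  the mean of \<open>log norm1\<close> over all words of length \<open>L\<close>, divided by \<open>L\<close>.  Letting \<open>L\<close> tend to infinity,
  the growth rate is the limit of these means (\<open>almost_additive.AE_tendsto_mean\<close>).  The
  hypothesis on \<open>S\<close> identifies that limit as \<open>\<alpha>\<^sub>0 log 2\<close>: most integers with \<open>L + 1\<close> binary digits lie in
  \<open>S\<close>, and the others contribute little since \<open>log norm1\<close> is at most linear in \<open>L\<close>
  (\<open>mean_log_norm_tendsto\<close>).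

  The number of changes between adjacent digits is almost additive as well, with mean \<open>(L - 1) / 2\<close>
  over words of length \<open>L\<close>.  The same result shows that the expansion of almost every \<open>t\<close>
  has infinitely many blocks and that its first \<open>s\<close> blocks have total length about \<open>2 s\<close>.  Hence
  \<open>log q\<^sub>s\<close> is about \<open>2 s\<close> times \<open>\<alpha>\<^sub>0 log 2\<close>, which is \<open>\<alpha>\<^sub>0 s log 4\<close>.
\<close>

(* The simplifier then keeps the start vector (1, 1) of the matrix products as it is. *)
declare One_nat_def [simp del]

section \<open>Recursion for the hyperbinary count\<close>

definition hyperbinary_reps :: "nat \<Rightarrow> (nat \<Rightarrow> nat) set" where
  "hyperbinary_reps n =
     {\<omega>. (\<forall>i. \<omega> i \<in> {0, 1, 2}) \<and> (\<lambda>i. \<omega> i * 2 ^ i) sums n}"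

lemma sums_nat_iff_eventually:
  fixes f :: "nat \<Rightarrow> nat"
  shows "f sums n \<longleftrightarrow> (\<forall>\<^sub>F k in sequentially. (\<Sum>i<k. f i) = n)"
  by (simp add: sums_def tendsto_discrete)

text \<open>
  Splitting off the least significant digit.  A natural number valued series converges only if
  its partial sums are eventually constant, so the parity of \<open>n\<close> agrees with that of
  the first digit \<open>\<omega> 0\<close>.
\<close>
lemma binary_sums_Suc_iff:
  fixes \<omega> :: "nat \<Rightarrow> nat"
  shows "(\<lambda>i. \<omega> i * 2 ^ i) sums n \<longleftrightarrow>
           (\<exists>m. n = \<omega> 0 + 2 * m \<and> (\<lambda>i. \<omega> (Suc i) * 2 ^ i) sums m)"
proof -
  have shift: "(\<Sum>i<Suc k. \<omega> i * 2 ^ i) = \<omega> 0 + 2 * (\<Sum>i<k. \<omega> (Suc i) * 2 ^ i)" for k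
    by (subst sum.lessThan_Suc_shift) (simp add: sum_distrib_left mult_ac)
  have *: "(\<lambda>i. \<omega> i * 2 ^ i) sums n \<longleftrightarrow>
      (\<forall>\<^sub>F k in sequentially. \<omega> 0 + 2 * (\<Sum>i<k. \<omega> (Suc i) * 2 ^ i) = n)"
    unfolding sums_nat_iff_eventually shift[symmetric]
    by (subst eventually_sequentially_Suc) simp
  show ?thesis
  proof
    assume "(\<lambda>i. \<omega> i * 2 ^ i) sums n"
    hence ev: "\<forall>\<^sub>F k in sequentially. \<omega> 0 + 2 * (\<Sum>i<k. \<omega> (Suc i) * 2 ^ i) = n"
      using * by simp
    then obtain k where "\<omega> 0 + 2 * (\<Sum>i<k. \<omega> (Suc i) * 2 ^ i) = n"
      using eventually_happens'[OF sequentially_bot] by blast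
    then obtain m where m: "n = \<omega> 0 + 2 * m" by blast
    have "(\<lambda>i. \<omega> (Suc i) * 2 ^ i) sums m"
      unfolding sums_nat_iff_eventually using ev by eventually_elim (simp add: m)
    thus "\<exists>m. n = \<omega> 0 + 2 * m \<and> (\<lambda>i. \<omega> (Suc i) * 2 ^ i) sums m" using m by blast
  next
    assume "\<exists>m. n = \<omega> 0 + 2 * m \<and> (\<lambda>i. \<omega> (Suc i) * 2 ^ i) sums m"
    then obtain m where m: "n = \<omega> 0 + 2 * m" "(\<lambda>i. \<omega> (Suc i) * 2 ^ i) sums m" by blast
    show "(\<lambda>i. \<omega> i * 2 ^ i) sums n"
      unfolding * using m(2)[unfolded sums_nat_iff_eventually]
      by eventually_elim (simp add: m(1))
  qed
qed

lemma hyperbinary_reps_Cons_iff: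
  "case_nat d \<omega> \<in> hyperbinary_reps n \<longleftrightarrow>
     d \<in> {0, 1, 2} \<and> (\<exists>m. n = d + 2 * m \<and> \<omega> \<in> hyperbinary_reps m)"
proof -
  have "(\<forall>i. case_nat d \<omega> i \<in> {0, 1, 2}) \<longleftrightarrow> d \<in> {0, 1, 2} \<and> (\<forall>i. \<omega> i \<in> {0, 1, 2})"
    by (metis not0_implies_Suc old.nat.simps(4) old.nat.simps(5))
  thus ?thesis
    unfolding hyperbinary_reps_def mem_Collect_eq binary_sums_Suc_iff[of "case_nat d \<omega>"] by auto
qed

lemma hyperbinary_reps_decompose:
  "hyperbinary_reps n = (\<Union>d\<in>{0,1,2}. \<Union>m\<in>{m. n = d + 2 * m}. case_nat d ` hyperbinary_reps m)"
  (is "?l = ?r")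
proof (rule set_eqI)
  fix \<omega> :: "nat \<Rightarrow> nat"
  have \<omega>: "\<omega> = case_nat (\<omega> 0) (\<lambda>i. \<omega> (Suc i))" by (auto split: nat.split)
  show "\<omega> \<in> ?l \<longleftrightarrow> \<omega> \<in> ?r"
  proof
    assume "\<omega> \<in> ?l"
    hence "case_nat (\<omega> 0) (\<lambda>i. \<omega> (Suc i)) \<in> hyperbinary_reps n" using \<omega> by simp
    thus "\<omega> \<in> ?r" unfolding hyperbinary_reps_Cons_iff using \<omega> by blast
  next
    assume "\<omega> \<in> ?r"
    thus "\<omega> \<in> ?l" using hyperbinary_reps_Cons_iff by blast
  qed
qed

lemma hyperbinary_reps_0: "hyperbinary_reps 0 = {\<lambda>_. 0}"
proof (rule set_eqI)
  fix \<omega>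
  have "\<omega> i = 0" if "\<omega> \<in> hyperbinary_reps 0" for i
    using that
  proof (induction i arbitrary: \<omega>)
    case 0
    thus ?case unfolding hyperbinary_reps_def mem_Collect_eq binary_sums_Suc_iff[of \<omega>] by auto
  next
    case (Suc i)
    have "(\<lambda>i. \<omega> (Suc i)) \<in> hyperbinary_reps 0"
      using Suc.prems
      unfolding hyperbinary_reps_def mem_Collect_eq binary_sums_Suc_iff[of \<omega>] by auto
    from Suc.IH[OF this] show ?case .
  qed
  moreover have "(\<lambda>_. 0) \<in> hyperbinary_reps 0" by (simp add: hyperbinary_reps_def)
  ultimately show "\<omega> \<in> hyperbinary_reps 0 \<longleftrightarrow> \<omega> \<in> {\<lambda>_. 0}" by auto
qed

lemma hyperbinary_reps_odd: "hyperbinary_reps (2 * n + 1) = case_nat 1 ` hyperbinary_reps n"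
proof -
  have "{m. 2 * n + 1 = 0 + 2 * m} = {}" "{m. 2 * n + 1 = 1 + 2 * m} = {n}"
    "{m. 2 * n + 1 = 2 + 2 * m} = {}" by (auto; presburger)+
  thus ?thesis by (subst hyperbinary_reps_decompose) (simp only: UN_insert UN_empty, simp)
qed

lemma hyperbinary_reps_even:
  "hyperbinary_reps (2 * n + 2) =
     case_nat 0 ` hyperbinary_reps (n + 1) \<union> case_nat 2 ` hyperbinary_reps n"
proof -
  have "{m. 2 * n + 2 = 0 + 2 * m} = {n + 1}" "{m. 2 * n + 2 = 1 + 2 * m} = {}"
    "{m. 2 * n + 2 = 2 + 2 * m} = {n}" by (auto; presburger)+
  thus ?thesis by (subst hyperbinary_reps_decompose) (simp only: UN_insert UN_empty, simp)
qed

lemma finite_hyperbinary_reps: "finite (hyperbinary_reps n)"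
proof (induction n rule: less_induct)
  case (less n)
  show ?case
  proof (cases "n = 0")
    case True
    thus ?thesis by (simp add: hyperbinary_reps_0)
  next
    case False
    show ?thesis
    proof (cases "even n")
      case True
      then obtain m where "n = 2 * m" by blast
      moreover from this False obtain k where "m = k + 1" by (cases m) auto
      ultimately have n: "n = 2 * k + 2" by simp
      show ?thesis using less[of "k + 1"] less[of k] by (simp add: n hyperbinary_reps_even del: add_2_eq_Suc')
    next
      case odd: False
      then obtain k where n: "n = 2 * k + 1" by (rule oddE)
      show ?thesis using less[of k] unfolding n hyperbinary_reps_odd by simp
    qed
  qed
qed

lemma inj_case_nat: "inj_on (case_nat (d :: nat)) A"
proof (rule inj_onI)
  fix x y assume "case_nat d x = case_nat d y"
  hence "case_nat d x (Suc i) = case_nat d y (Suc i)" for i by (rule fun_cong)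
  thus "x = y" by (simp add: fun_eq_iff)
qed

lemma hyperbinary_count_eq: "hyperbinary_count n = card (hyperbinary_reps n)"
  by (simp add: hyperbinary_count_def hyperbinary_reps_def)

lemma hyperbinary_count_0: "hyperbinary_count 0 = 1"
  by (simp add: hyperbinary_count_eq hyperbinary_reps_0)

lemma hyperbinary_count_odd: "hyperbinary_count (2 * n + 1) = hyperbinary_count n"
  unfolding hyperbinary_count_eq hyperbinary_reps_odd by (rule card_image[OF inj_case_nat])

lemma hyperbinary_count_even:
  "hyperbinary_count (2 * n + 2) = hyperbinary_count (n + 1) + hyperbinary_count n"
proof -
  have disj: "case_nat 0 ` A \<inter> case_nat (2::nat) ` B = {}" for A B :: "(nat \<Rightarrow> nat) set"
  proof (rule equals0I)
    fix \<omega> assume "\<omega> \<in> case_nat 0 ` A \<inter> case_nat (2::nat) ` B"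
    then obtain x y where x: "\<omega> = case_nat 0 x" and y: "\<omega> = case_nat 2 y" by blast
    have "\<omega> 0 = 0" using x by simp
    moreover have "\<omega> 0 = 2" using y by simp
    ultimately show False by simp
  qed
  show ?thesis
    unfolding hyperbinary_count_eq hyperbinary_reps_even
    by (subst card_Un_disjoint)
       (simp_all add: finite_hyperbinary_reps card_image inj_case_nat disj)
qed


section \<open>Matrix products along binary words\<close>

text \<open>
  The last \<open>m\<close> binary digits of \<open>n\<close>, most significant digit first and padded with zeros.
\<close>
fun bits :: "nat \<Rightarrow> nat \<Rightarrow> bool list" where
  "bits 0 n = []"
| "bits (Suc m) n = bits m (n div 2) @ [odd n]"

lemma length_bits [simp]: "length (bits m n) = m"
  by (induction m arbitrary: n) auto

lemma bits_append:
  assumes "r < 2 ^ L"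
  shows "bits (m + L) (2 ^ L * n + r) = bits m n @ bits L r"
  using assms
proof (induction L arbitrary: r)
  case (Suc L)
  have "(2 ^ Suc L * n + r) div 2 = 2 ^ L * n + r div 2" by simp
  moreover have "odd (2 ^ Suc L * n + r) = odd r" by simp
  moreover have "r div 2 < 2 ^ L" using Suc.prems by simp
  ultimately show ?case using Suc.IH[of "r div 2"] by simp
qed simp

text \<open>
  The action of a digit on column vectors: the elementary matrices with rows \<open>(1, 0), (1, 1)\<close>
  (digit 1) and \<open>(1, 1), (0, 1)\<close> (digit 0).
\<close>
definition step :: "bool \<Rightarrow> nat \<times> nat \<Rightarrow> nat \<times> nat" where
  "step b p = (if b then (fst p, fst p + snd p) else (fst p + snd p, snd p))"

text \<open>
  The recursion of the hyperbinary count, applied to \<open>n\<close> and \<open>n - 1\<close> at the same time, is \<^const>\<open>step\<close>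
  for the last digit of \<open>n\<close>.  The start vector \<open>(1, 1)\<close> belongs to the leading digit 1 of \<open>2\<^sup>L + r\<close>.
\<close>
lemma fold_step_bits:
  assumes "r < 2 ^ L"
  shows "fold step (bits L r) (1, 1) =
           (hyperbinary_count (2 ^ L + r), hyperbinary_count (2 ^ L + r - 1))"
  using assms
proof (induction L arbitrary: r)
  case 0
  thus ?case using hyperbinary_count_odd[of 0] by (simp add: hyperbinary_count_0)
next
  case (Suc L)
  define n where "n = 2 ^ L + r div 2"
  obtain k where k: "n = k + 1"
    using not0_implies_Suc[of n] by (auto simp: n_def)
  have IH: "fold step (bits L (r div 2)) (1, 1) = (hyperbinary_count n, hyperbinary_count k)"
    using Suc.IH[of "r div 2"] Suc.prems k by (simp add: n_def)
  have even: "hyperbinary_count (2 * n) = hyperbinary_count n + hyperbinary_count k"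
    using hyperbinary_count_even[of k] by (simp add: k)
  show ?case
  proof (cases "odd r")
    case True
    hence "2 ^ Suc L + r = 2 * n + 1" unfolding n_def power_Suc by presburger
    thus ?thesis using True IH even hyperbinary_count_odd[of n] step_def[of True] by simp
  next
    case False
    hence "2 ^ Suc L + r = 2 * n" unfolding n_def power_Suc by presburger
    moreover have "2 * n - 1 = 2 * k + 1" by (simp add: k)
    ultimately show ?thesis
      using False IH even hyperbinary_count_odd[of k] step_def[of False] by simp
  qed
qed

text \<open>
  The values of \<open>mass w\<close> at the unit vectors are the column sums of the matrix product, and its value at
  \<open>(1, 1)\<close> is the sum of all entries, which serves as the norm (\<open>norm1\<close> below).
\<close>
definition mass :: "bool list \<Rightarrow> nat \<times> nat \<Rightarrow> nat" where
  "mass w p = fst (fold step w p) + snd (fold step w p)"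

lemma mass_Nil [simp]: "mass [] p = fst p + snd p"
  and mass_Cons: "mass (b # w) p = mass w (step b p)"
  and mass_append: "mass (u @ v) p = mass v (fold step u p)"
  by (simp_all add: mass_def)

lemma mass_linear: "mass w (x, y) = x * mass w (1, 0) + y * mass w (0, 1)"
proof (induction w arbitrary: x y)
  case (Cons b w)
  show ?case
    unfolding mass_Cons step_def fst_conv snd_conv
    by (cases b) (simp_all add: Cons[of "x + y" y] Cons[of x "x + y"] Cons[of 1 1] algebra_simps)
qed simp

text \<open>
  Prepending a digit replaces one of the two column sums by the sum of both.  So the ratio of the
  columns can grow only while one digit is repeated, and then by 1 for each repetition.
\<close>
lemma mass_column_comparable:
  "mass w (0, 1) \<le> (length w + 1) * mass w (1, 0)"
  "mass w (1, 0) \<le> (length w + 1) * mass w (0, 1)"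
proof (induction w)
  case (Cons b w)
  have "mass w (1, 1) = mass w (1, 0) + mass w (0, 1)" using mass_linear[of w 1 1] by simp
  with Cons show "mass (b # w) (0, 1) \<le> (length (b # w) + 1) * mass (b # w) (1, 0)"
     "mass (b # w) (1, 0) \<le> (length (b # w) + 1) * mass (b # w) (0, 1)"
    by (cases b; simp add: mass_Cons step_def)+
qed auto

text \<open>
  The same for rows: appending a digit replaces one of the two coordinates by the sum of both.
\<close>
lemma fold_step_comparable:
  "fst (fold step w (1, 1)) \<le> (length w + 1) * snd (fold step w (1, 1))"
  "snd (fold step w (1, 1)) \<le> (length w + 1) * fst (fold step w (1, 1))"
  by (induction w rule: rev_induct) (auto simp: step_def)

abbreviation "norm1 w \<equiv> mass w (1, 1)"

lemma mass_submult: "norm1 (u @ v) \<le> norm1 u * norm1 v"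
proof -
  obtain x y where p: "fold step u (1, 1) = (x, y)" by fastforce
  have "norm1 (u @ v) = x * mass v (1,0) + y * mass v (0,1)"
    by (simp add: mass_append p mass_linear[of v x y])
  also have "\<dots> \<le> (x + y) * (mass v (1,0) + mass v (0,1))"
    by (simp add: algebra_simps)
  also have "\<dots> = norm1 u * norm1 v"
    using mass_linear[of v 1 1] by (simp add: mass_def[of u] p)
  finally show ?thesis .
qed

text \<open>
  If a run of equal digits is cut in the middle, the norm of the whole can be smaller than the product of
  the norms by a factor of the order of the length of the run.  This is the only loss:
  each column sum of \<open>v\<close> is at least the fraction \<open>1 / (length v + 2)\<close> of \<open>norm1 v\<close> by
  \<open>mass_column_comparable\<close>.
\<close>
lemma mass_supermult: "norm1 u * norm1 v \<le> 2 * (length v + 2) * norm1 (u @ v)"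
proof -
  obtain x y where p: "fold step u (1, 1) = (x, y)" by fastforce
  define c d n where "c = mass v (1,0)" and "d = mass v (0,1)" and "n = length v + 1"
  have uv: "norm1 (u @ v) = x * c + y * d"
    by (simp add: mass_append p mass_linear[of v x y] c_def d_def)
  have v: "norm1 v = c + d" using mass_linear[of v 1 1] by (simp add: c_def d_def)
  have u: "norm1 u = x + y" by (simp add: mass_def p)
  have cd: "d \<le> n * c" "c \<le> n * d"
    using mass_column_comparable[of v] by (simp_all add: c_def d_def n_def)
  have 1: "x * (c + d) \<le> x * ((n + 1) * c)" "y * (c + d) \<le> y * ((n + 1) * d)"
    using cd by (intro mult_left_mono; simp add: algebra_simps)+
  have "(x + y) * (c + d) = x * (c + d) + y * (c + d)" by (rule add_mult_distrib)
  also have "\<dots> \<le> x * ((n + 1) * c) + y * ((n + 1) * d)" by (rule add_mono[OF 1])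
  also have "\<dots> = (n + 1) * (x * c + y * d)" by (simp add: algebra_simps)
  also have "\<dots> \<le> 2 * (n + 1) * (x * c + y * d)" by (intro mult_right_mono) auto
  finally show ?thesis unfolding u v uv n_def by simp
qed

lemma norm1_pos: "norm1 w > 0"
  by (induction w rule: rev_induct) (auto simp: mass_def step_def)

lemma norm1_le: "norm1 w \<le> 2 ^ Suc (length w)"
  by (induction w rule: rev_induct) (auto simp: mass_def step_def)

section \<open>A strong law of large numbers for digits\<close>

lemma sum_lessThan_mult:
  fixes h :: "nat \<Rightarrow> 'a::comm_monoid_add"
  shows "(\<Sum>n<a * b. h n) = (\<Sum>m<a. \<Sum>c<b. h (m * b + c))"
proof (induction a)
  case (Suc a)
  have "(\<Sum>n<x + y. h n) = (\<Sum>n<x. h n) + (\<Sum>c<y. h (x + c))" for x y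
    by (induction y) (simp_all add: add_ac)
  from this[of "a * b" b] Suc show ?case by (simp add: add_ac)
qed simp

text \<open>
  The integer whose base \<open>Q\<close> digits are the first \<open>k\<close> digits of \<open>t\<close> after the point.
\<close>
definition prefix :: "nat \<Rightarrow> nat \<Rightarrow> real \<Rightarrow> nat" where
  "prefix Q k t = nat \<lfloor>real Q ^ k * t\<rfloor>"

lemma prefix_eq_iff:
  assumes "t \<ge> 0" "Q > 0"
  shows "prefix Q k t = n \<longleftrightarrow> real n \<le> real Q ^ k * t \<and> real Q ^ k * t < real n + 1"
proof -
  have "0 \<le> \<lfloor>real Q ^ k * t\<rfloor>" using assms by simp
  hence "prefix Q k t = n \<longleftrightarrow> \<lfloor>real Q ^ k * t\<rfloor> = int n" unfolding prefix_def by linarith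
  thus ?thesis by (simp add: floor_eq_iff)
qed

lemma prefix_less:
  assumes "t \<in> {0..<1}" "Q > 0"
  shows "prefix Q k t < Q ^ k"
proof -
  have "real (prefix Q k t) \<le> real Q ^ k * t" using prefix_eq_iff[of t Q k] assms by auto
  also have "\<dots> < real Q ^ k" using assms by simp
  finally show ?thesis by (simp flip: of_nat_power)
qed

lemma prefix_add_div:
  assumes "t \<ge> 0" "Q > 0"
  shows "prefix Q (k + l) t div Q ^ l = prefix Q k t"
proof -
  define n where "n = prefix Q (k + l) t"
  have n: "real n \<le> real Q ^ (k + l) * t" "real Q ^ (k + l) * t < real n + 1"
    using prefix_eq_iff[OF assms, of "k + l" n] by (simp_all add: n_def)
  have pos: "real Q ^ l > 0" "Q ^ l > 0" using assms by simp_all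
  have "n div Q ^ l * Q ^ l \<le> n" by simp
  hence "real (n div Q ^ l * Q ^ l) \<le> real n" by (rule of_nat_mono)
  hence "real (n div Q ^ l) * real Q ^ l \<le> real Q ^ k * t * real Q ^ l"
    using n(1) by (simp add: power_add mult_ac)
  moreover have "n < n div Q ^ l * Q ^ l + Q ^ l"
    using pos by (metis add.commute dividend_less_times_div mult.commute)
  hence "n + 1 \<le> n div Q ^ l * Q ^ l + Q ^ l" by simp
  hence "real (n + 1) \<le> real (n div Q ^ l * Q ^ l + Q ^ l)" by (rule of_nat_mono)
  hence "real Q ^ k * t * real Q ^ l < (real (n div Q ^ l) + 1) * real Q ^ l"
    using n(2) by (simp add: power_add algebra_simps)
  ultimately show ?thesis
    using prefix_eq_iff[OF assms, of k "n div Q ^ l"] pos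
    by (simp add: n_def mult_le_cancel_right_pos)
qed

text \<open>
  The first \<open>k\<close> digits are uniformly distributed.  This is the only property of Lebesgue measure that
  the law of large numbers rests on; everything else is counting.
\<close>
lemma measure_prefix:
  assumes "Q > 0"
  shows "{t \<in> {0..<1}. P (prefix Q k t)} \<in> sets lborel"
    and "emeasure lborel {t \<in> {0..<1}. P (prefix Q k t)} < \<infinity>"
    and "measure lborel {t \<in> {0..<1}. P (prefix Q k t)} = card {n \<in> {..<Q ^ k}. P n} / real Q ^ k"
proof -
  define A where "A n = {t \<in> {0..<1}. prefix Q k t = n}" for n
  have q: "real Q ^ k > 0" using assms by simp
  have A: "A n = {real n / real Q ^ k ..< (real n + 1) / real Q ^ k}" if "n < Q ^ k" for n
  proof -
    have "real (n + 1) \<le> real (Q ^ k)" using that by (intro of_nat_mono) simp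
    hence "(real n + 1) / real Q ^ k \<le> 1" using q by (simp add: field_simps)
    have "t \<in> A n \<longleftrightarrow> t \<in> {real n / real Q ^ k ..< (real n + 1) / real Q ^ k}" for t
    proof (cases "t \<ge> 0")
      case True
      thus ?thesis
        using prefix_eq_iff[OF True assms, of k n] pos_divide_le_eq[OF q, of "real n" t]
          pos_less_divide_eq[OF q, of t "real n + 1"] \<open>(real n + 1) / real Q ^ k \<le> 1\<close>
        by (auto simp: A_def mult.commute)
    next
      case False
      moreover have "0 \<le> real n / real Q ^ k" by simp
      ultimately have "\<not> real n / real Q ^ k \<le> t" by linarith
      with False show ?thesis by (auto simp: A_def)
    qed
    thus ?thesis by blast
  qed
  have eq: "{t \<in> {0..<1}. P (prefix Q k t)} = (\<Union>n\<in>{n \<in> {..<Q ^ k}. P n}. A n)"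
    unfolding A_def using prefix_less[OF _ assms, of _ k] by auto
  have em: "emeasure lborel (A n) = ennreal (1 / real Q ^ k)" if "n < Q ^ k" for n
    using q by (simp add: A[OF that] field_simps)
  hence mA: "measure lborel (A n) = 1 / real Q ^ k" if "n < Q ^ k" for n
    using that by (simp add: measure_def)
  show 1: "{t \<in> {0..<1}. P (prefix Q k t)} \<in> sets lborel"
    unfolding eq by (intro sets.finite_UN) (auto simp: A)
  have "emeasure lborel {t \<in> {0..<1}. P (prefix Q k t)} \<le> emeasure lborel {0..<1::real}"
    by (rule emeasure_mono) auto
  thus "emeasure lborel {t \<in> {0..<1}. P (prefix Q k t)} < \<infinity>"
    by (simp add: order.strict_trans1)
  have "measure lborel (\<Union>n\<in>{n \<in> {..<Q ^ k}. P n}. A n)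
      = (\<Sum>n\<in>{n \<in> {..<Q ^ k}. P n}. measure lborel (A n))"
  proof (rule measure_finite_Union)
    show "A ` {n \<in> {..<Q ^ k}. P n} \<subseteq> sets lborel" using A by auto
    show "disjoint_family_on A {n \<in> {..<Q ^ k}. P n}" by (auto simp: disjoint_family_on_def A_def)
    show "emeasure lborel (A n) \<noteq> \<infinity>" if "n \<in> {n \<in> {..<Q ^ k}. P n}" for n
      using em[of n] that by simp
  qed simp
  thus "measure lborel {t \<in> {0..<1}. P (prefix Q k t)} = card {n \<in> {..<Q ^ k}. P n} / real Q ^ k"
    unfolding eq by (simp add: mA)
qed

text \<open>
  The sum of \<open>\<phi>\<close> over the last \<open>k\<close> base \<open>Q\<close> digits of \<open>n\<close>.  For \<open>n = prefix Q k t\<close> these are the first \<open>k\<close>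
  digits of \<open>t\<close>.
\<close>
primrec digit_sum :: "(nat \<Rightarrow> real) \<Rightarrow> nat \<Rightarrow> nat \<Rightarrow> nat \<Rightarrow> real" where
  "digit_sum \<phi> Q 0 n = 0"
| "digit_sum \<phi> Q (Suc k) n = digit_sum \<phi> Q k (n div Q) + \<phi> (n mod Q)"

text \<open>
  Independence of the digits, in the form of multiplicativity of the moment generating function.
\<close>
lemma sum_exp_digit_sum:
  assumes "Q > 0"
  shows "(\<Sum>n<Q ^ k. exp (l * digit_sum \<phi> Q k n)) = (\<Sum>c<Q. exp (l * \<phi> c)) ^ k"
proof (induction k)
  case (Suc k)
  have "(\<Sum>n<Q ^ Suc k. exp (l * digit_sum \<phi> Q (Suc k) n))
      = (\<Sum>n<Q ^ k * Q. exp (l * digit_sum \<phi> Q (Suc k) n))" by (simp add: mult.commute)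
  also have "\<dots> = (\<Sum>m<Q ^ k. \<Sum>c<Q. exp (l * digit_sum \<phi> Q k m) * exp (l * \<phi> c))"
    unfolding sum_lessThan_mult using assms
    by (intro sum.cong refl) (simp add: div_mult_self3 distrib_left exp_add)
  also have "\<dots> = (\<Sum>m<Q ^ k. exp (l * digit_sum \<phi> Q k m)) * (\<Sum>c<Q. exp (l * \<phi> c))"
    by (simp add: sum_product)
  finally show ?case using Suc by simp
qed simp

lemma exp_le_quadratic:
  fixes x :: real
  assumes "\<bar>x\<bar> \<le> 1"
  shows "exp x \<le> 1 + x + x\<^sup>2"
proof (cases "x \<ge> 0")
  case True
  thus ?thesis using assms exp_bound[of x] by simp
next
  case False
  define y where "y = - x"
  have y: "0 \<le> y" using False by (simp add: y_def)
  have "exp x = 1 / exp y" by (simp add: y_def exp_minus inverse_eq_divide)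
  also have "\<dots> \<le> 1 / (1 + y)" using y exp_ge_add_one_self[of y] by (intro divide_left_mono) auto
  also have "\<dots> \<le> 1 - y + y\<^sup>2"
  proof -
    have "(1 - y + y\<^sup>2) * (1 + y) = 1 + y ^ 3" by (simp add: power2_eq_square power3_eq_cube algebra_simps)
    hence "1 \<le> (1 - y + y\<^sup>2) * (1 + y)" using y by simp
    thus ?thesis using y by (simp add: divide_le_eq)
  qed
  finally show ?thesis by (simp add: y_def)
qed

text \<open>
  Chernoff's bound.  As \<open>\<phi>\<close> has mean zero, \<open>exp x \<le> 1 + x + x\<^sup>2\<close> bounds the mean of \<open>exp (l \<phi>)\<close> by
  \<open>1 + l\<^sup>2 B\<^sup>2 \<le> exp (l \<epsilon> / 2)\<close>, which is smaller by the factor \<open>exp (- l \<epsilon> / 2)\<close> than the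
  weight \<open>exp (l \<epsilon>)\<close> per digit in Markov's inequality.
\<close>
lemma card_digit_sum_large:
  fixes \<epsilon> :: real
  assumes "Q > 0" "\<And>c. c < Q \<Longrightarrow> \<bar>\<phi> c\<bar> \<le> B" "(\<Sum>c<Q. \<phi> c) = 0"
    and l: "0 < l" "l * B \<le> 1" "l * B\<^sup>2 \<le> \<epsilon> / 2"
  shows "card {n \<in> {..<Q ^ k}. digit_sum \<phi> Q k n > \<epsilon> * k} / real Q ^ k \<le> exp (- (l * \<epsilon> / 2)) ^ k"
proof -
  let ?A = "{n \<in> {..<Q ^ k}. digit_sum \<phi> Q k n > \<epsilon> * k}"
  have q: "real Q > 0" using assms(1) by simp
  have bound: "exp (l * \<phi> c) \<le> 1 + l * \<phi> c + l * (\<epsilon> / 2)" if "c < Q" for c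
  proof -
    have "\<bar>l * \<phi> c\<bar> \<le> l * B" using assms(2)[OF that] l by (simp add: abs_mult)
    moreover have "(l * \<phi> c)\<^sup>2 \<le> l * (\<epsilon> / 2)"
    proof -
      have "(\<phi> c)\<^sup>2 \<le> B\<^sup>2" using assms(2)[OF that] by (simp add: abs_le_square_iff[symmetric])
      hence "l * (\<phi> c)\<^sup>2 \<le> l * B\<^sup>2" using l by simp
      hence "l * (l * (\<phi> c)\<^sup>2) \<le> l * (\<epsilon> / 2)" using l by (intro mult_left_mono) linarith+
      thus ?thesis by (simp add: power2_eq_square mult_ac)
    qed
    ultimately show ?thesis using exp_le_quadratic[of "l * \<phi> c"] l by linarith
  qed
  have "(\<Sum>c<Q. exp (l * \<phi> c)) \<le> (\<Sum>c<Q. 1 + l * \<phi> c + l * (\<epsilon> / 2))"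
    using bound by (intro sum_mono) simp
  also have "\<dots> = Q * (1 + l * (\<epsilon> / 2))"
    using assms(3) by (simp add: sum.distrib algebra_simps flip: sum_distrib_left)
  also have "\<dots> \<le> Q * exp (l * \<epsilon> / 2)"
    using q exp_ge_add_one_self[of "l * (\<epsilon> / 2)"] by (intro mult_left_mono) auto
  finally have mgf: "(\<Sum>c<Q. exp (l * \<phi> c)) \<le> Q * exp (l * \<epsilon> / 2)" .
  have "card ?A * exp (l * (\<epsilon> * k)) = (\<Sum>n\<in>?A. exp (l * (\<epsilon> * k)))" by simp
  also have "\<dots> \<le> (\<Sum>n\<in>?A. exp (l * digit_sum \<phi> Q k n))"
    using l by (intro sum_mono) auto
  also have "\<dots> \<le> (\<Sum>n<Q ^ k. exp (l * digit_sum \<phi> Q k n))"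
    by (intro sum_mono2) auto
  also have "\<dots> \<le> (Q * exp (l * \<epsilon> / 2)) ^ k"
    unfolding sum_exp_digit_sum[OF assms(1)] using mgf by (intro power_mono sum_nonneg) auto
  finally have "card ?A * exp (l * (\<epsilon> * k)) \<le> (Q * exp (l * \<epsilon> / 2)) ^ k" .
  hence "card ?A / real Q ^ k \<le> exp (l * \<epsilon> / 2) ^ k / exp (l * (\<epsilon> * k))"
    using q by (simp add: field_simps power_mult_distrib)
  also have "\<dots> = exp (- (l * \<epsilon> / 2)) ^ k"
    by (simp add: exp_of_nat_mult[symmetric] exp_diff[symmetric] algebra_simps)
  finally show ?thesis .
qed

text \<open>
  The exceptional sets have exponentially small measure, so the Borel--Cantelli lemma applies.
\<close>
lemma AE_digit_sum_le:
  fixes \<epsilon> :: real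
  assumes "Q > 0" "(\<Sum>c<Q. \<phi> c) = 0" "\<epsilon> > 0"
  shows "AE t in lborel. t \<in> {0..<1} \<longrightarrow>
           (\<forall>\<^sub>F k in sequentially. digit_sum \<phi> Q k (prefix Q k t) \<le> \<epsilon> * k)"
proof -
  define B where "B = 1 + (\<Sum>c<Q. \<bar>\<phi> c\<bar>)"
  have B: "\<bar>\<phi> c\<bar> \<le> B" if "c < Q" for c
    using member_le_sum[of c "{..<Q}" "\<lambda>c. \<bar>\<phi> c\<bar>"] that by (simp add: B_def)
  have B1: "B \<ge> 1" by (simp add: B_def sum_nonneg)
  define l where "l = min (1 / B) (\<epsilon> / (2 * B\<^sup>2))"
  have l: "0 < l" using B1 assms(3) by (simp add: l_def)
  have "l \<le> 1 / B" "l \<le> \<epsilon> / (2 * B\<^sup>2)" by (simp_all add: l_def)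
  hence lB: "l * B \<le> 1" "l * B\<^sup>2 \<le> \<epsilon> / 2" using B1 by (simp_all add: field_simps)
  define A where "A k = {t \<in> {0..<1}. digit_sum \<phi> Q k (prefix Q k t) > \<epsilon> * k}" for k
  have "summable (\<lambda>k. measure lborel (A k))"
  proof (rule summable_comparison_test')
    show "summable (\<lambda>k. exp (- (l * \<epsilon> / 2)) ^ k)"
      using l assms(3) by (intro summable_geometric) simp
    show "norm (measure lborel (A k)) \<le> exp (- (l * \<epsilon> / 2)) ^ k" if "k \<ge> 0" for k
      using card_digit_sum_large[OF assms(1) B assms(2) l lB, of k]
        measure_prefix(3)[OF assms(1), of "\<lambda>n. digit_sum \<phi> Q k n > \<epsilon> * k" k]
      by (simp add: A_def)
  qed
  hence "AE t in lborel. \<forall>\<^sub>F k in sequentially. t \<in> space lborel - A k"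
    using measure_prefix(1,2)[OF assms(1)] by (intro borel_cantelli_AE1) (auto simp: A_def)
  thus ?thesis
  proof (rule AE_mp, intro AE_I2 impI)
    fix t :: real
    assume "\<forall>\<^sub>F k in sequentially. t \<in> space lborel - A k" "t \<in> {0..<1}"
    thus "\<forall>\<^sub>F k in sequentially. digit_sum \<phi> Q k (prefix Q k t) \<le> \<epsilon> * k"
      by (auto elim!: eventually_mono simp: A_def not_less)
  qed
qed

lemma digit_sum_affine:
  "digit_sum (\<lambda>c. a * \<phi> c + b) Q k n = a * digit_sum \<phi> Q k n + b * k"
  by (induction k arbitrary: n) (simp_all add: algebra_simps)

lemma abs_diff_mult_divide:
  fixes x c k :: real
  assumes "k > 0"
  shows "\<bar>x - c * k\<bar> / k = \<bar>x / k - c\<bar>"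
proof -
  have "x - c * k = (x / k - c) * k" using assms by (simp add: left_diff_distrib)
  hence "\<bar>x - c * k\<bar> = \<bar>x / k - c\<bar> * k" using assms by (simp add: abs_mult)
  thus ?thesis using assms by simp
qed

text \<open>
  Both one-sided bounds, for \<open>\<phi>\<close> minus its mean and for the negative of this, with \<open>\<epsilon> = 1 / (j + 1)\<close> for
  all \<open>j\<close> at once.
\<close>
theorem AE_digit_average:
  assumes "Q > 0"
  shows "AE t in lborel. t \<in> {0..<1} \<longrightarrow>
           (\<lambda>k. digit_sum \<phi> Q k (prefix Q k t) / k) \<longlonglongrightarrow> (\<Sum>c<Q. \<phi> c) / Q"
proof -
  define \<mu> where "\<mu> = (\<Sum>c<Q. \<phi> c) / Q"
  have \<mu>: "(\<Sum>c<Q. \<phi> c) = Q * \<mu>" using assms by (simp add: \<mu>_def)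
  have "AE t in lborel. t \<in> {0..<1} \<longrightarrow> (\<forall>\<^sub>F k in sequentially.
          digit_sum (\<lambda>c. 1 * \<phi> c + (- \<mu>)) Q k (prefix Q k t) \<le> inverse (Suc j) * k)" for j
    using AE_digit_sum_le[OF assms, of "\<lambda>c. 1 * \<phi> c + (- \<mu>)" "inverse (real (Suc j))"] \<mu>
    by (simp add: sum_subtractf)
  hence 1: "AE t in lborel. \<forall>j. t \<in> {0..<1} \<longrightarrow> (\<forall>\<^sub>F k in sequentially.
          digit_sum (\<lambda>c. 1 * \<phi> c + (- \<mu>)) Q k (prefix Q k t) \<le> inverse (Suc j) * k)"
    by (subst AE_all_countable) blast
  have "AE t in lborel. t \<in> {0..<1} \<longrightarrow> (\<forall>\<^sub>F k in sequentially.
          digit_sum (\<lambda>c. (- 1) * \<phi> c + \<mu>) Q k (prefix Q k t) \<le> inverse (Suc j) * k)" for j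
    using AE_digit_sum_le[OF assms, of "\<lambda>c. (- 1) * \<phi> c + \<mu>" "inverse (real (Suc j))"] \<mu>
    by (simp add: sum_subtractf)
  hence 2: "AE t in lborel. \<forall>j. t \<in> {0..<1} \<longrightarrow> (\<forall>\<^sub>F k in sequentially.
          digit_sum (\<lambda>c. (- 1) * \<phi> c + \<mu>) Q k (prefix Q k t) \<le> inverse (Suc j) * k)"
    by (subst AE_all_countable) blast
  from 1 2 show ?thesis
  proof eventually_elim
    case (elim t)
    show ?case unfolding \<mu>_def[symmetric]
    proof (intro impI LIMSEQ_I)
      fix r :: real assume t: "t \<in> {0..<1}" and r: "r > 0"
      obtain j where j: "inverse (Suc j) < r" using reals_Archimedean[OF r] by blast
      have "\<forall>\<^sub>F k in sequentially. norm (digit_sum \<phi> Q k (prefix Q k t) / k - \<mu>) < r"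
        using elim(1)[rule_format, OF t, of j] elim(2)[rule_format, OF t, of j] eventually_gt_at_top[of 0]
      proof eventually_elim
        case (elim k)
        hence "\<bar>digit_sum \<phi> Q k (prefix Q k t) - \<mu> * k\<bar> \<le> inverse (Suc j) * k"
          unfolding digit_sum_affine by (simp add: abs_le_iff)
        also have "\<dots> < r * k" using j elim(3) by (intro mult_strict_right_mono) auto
        finally have "\<bar>digit_sum \<phi> Q k (prefix Q k t) - \<mu> * k\<bar> / k < r"
          using elim(3) by (simp add: divide_less_eq)
        moreover have "\<bar>digit_sum \<phi> Q k (prefix Q k t) - \<mu> * k\<bar> / k = \<bar>digit_sum \<phi> Q k (prefix Q k t) / k - \<mu>\<bar>"
          using elim(3) abs_diff_mult_divide[of k] by simp
        ultimately show ?case by simp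
      qed
      thus "\<exists>no. \<forall>k\<ge>no. norm (digit_sum \<phi> Q k (prefix Q k t) / k - \<mu>) < r"
        by (simp add: eventually_sequentially)
    qed
  qed
qed

section \<open>Mean growth of the matrix products\<close>

lemma density_one_infinite:
  assumes "has_natural_density S 1"
  shows "infinite S"
proof
  assume fin: "finite S"
  have lim: "(\<lambda>N. real (card S) / real N) \<longlonglongrightarrow> 0"
    by real_asymp
  have "card (S \<inter> {1..<N}) \<le> card S" for N
    using fin by (intro card_mono) auto
  hence le: "\<forall>\<^sub>F N in sequentially. real (card (S \<inter> {1..<N})) / real N \<le> real (card S) / real N"
    by (intro always_eventually allI divide_right_mono of_nat_mono) simp_all
  have ge: "\<forall>\<^sub>F N in sequentially. 0 \<le> real (card (S \<inter> {1..<N})) / real N" by simp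
  have "(\<lambda>N. real (card (S \<inter> {1..<N})) / real N) \<longlonglongrightarrow> 0"
    by (rule tendsto_sandwich[OF ge le tendsto_const lim])
  moreover have "(\<lambda>N. real (card (S \<inter> {1..<N})) / real N) \<longlonglongrightarrow> 1"
    using assms by (simp add: has_natural_density_def)
  ultimately show False using LIMSEQ_unique by fastforce
qed

text \<open>
  The integers with \<open>L + 1\<close> binary digits outside \<open>S\<close>, given by their digits after the leading 1.
\<close>
definition exceptions :: "nat set \<Rightarrow> nat \<Rightarrow> nat set" where
  "exceptions S L = {r \<in> {..<2 ^ L}. 2 ^ L + r \<notin> S}"

text \<open>
  The integers below \<open>2\<^sup>L\<^sup>+\<^sup>1\<close> outside \<open>S\<close> are \<open>o(2\<^sup>L\<^sup>+\<^sup>1)\<close> in number, and restricting to the upper half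
  of the range at most doubles their proportion.
\<close>
lemma exceptions_negligible:
  assumes "has_natural_density S 1"
  shows "(\<lambda>L. card (exceptions S L) / 2 ^ L) \<longlonglongrightarrow> 0"
proof -
  define d where "d N = real (card (S \<inter> {1..<N})) / real N" for N
  have "filterlim (\<lambda>L::nat. 2 ^ Suc L :: nat) at_top sequentially"
    by (rule filterlim_at_top_mono[OF filterlim_Suc])
       (auto intro!: always_eventually less_imp_le simp del: power_Suc)
  hence "(\<lambda>L. d (2 ^ Suc L)) \<longlonglongrightarrow> 1"
    by (rule filterlim_compose[rotated]) (use assms in \<open>simp add: has_natural_density_def d_def[abs_def]\<close>)
  hence lim: "(\<lambda>L. 2 * (1 - d (2 ^ Suc L))) \<longlonglongrightarrow> 2 * (1 - 1)"
    by (intro tendsto_intros)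
  have "card (exceptions S L) / 2 ^ L \<le> 2 * (1 - d (2 ^ Suc L))" for L
  proof -
    let ?A = "(+) (2 ^ L) ` exceptions S L" and ?B = "S \<inter> {1..<2 ^ Suc L}"
    have fin: "finite (exceptions S L)" by (simp add: exceptions_def)
    have "card ?A + card ?B = card (?A \<union> ?B)"
      using fin by (intro card_Un_disjoint[symmetric]) (auto simp: exceptions_def)
    also have "\<dots> \<le> card {..<2 ^ Suc L :: nat}"
      by (intro card_mono) (auto simp: exceptions_def)
    finally have "card (exceptions S L) + card ?B \<le> 2 ^ Suc L" by (simp add: card_image)
    hence "real (card (exceptions S L) + card ?B) \<le> real (2 ^ Suc L)" by (rule of_nat_mono)
    hence "real (card (exceptions S L)) / 2 ^ L \<le> (2 * 2 ^ L - real (card ?B)) / 2 ^ L"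
      by (intro divide_right_mono) auto
    also have "\<dots> = 2 * (1 - d (2 ^ Suc L))" by (simp add: d_def field_simps)
    finally show ?thesis .
  qed
  hence le: "\<forall>\<^sub>F L in sequentially. card (exceptions S L) / 2 ^ L \<le> 2 * (1 - d (2 ^ Suc L))"
    by simp
  have ge: "\<forall>\<^sub>F L in sequentially. 0 \<le> card (exceptions S L) / 2 ^ L" by simp
  show ?thesis
    using tendsto_sandwich[OF ge le tendsto_const[of 0]] lim by simp
qed

text \<open>
  Here \<open>norm1 (bits L r) = N n + N (n - 1)\<close>, and rows are comparable, so the hypothesis, which is
  about \<open>N n\<close> alone, controls \<open>norm1\<close>.
\<close>
lemma norm1_bits_hyperbinary:
  assumes "r < 2 ^ L"
  defines "n \<equiv> 2 ^ L + r"
  shows "hyperbinary_count n > 0"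
    and "hyperbinary_count n \<le> norm1 (bits L r)"
    and "norm1 (bits L r) \<le> (L + 2) * hyperbinary_count n"
proof -
  note p = fold_step_bits[OF assms(1), folded n_def]
  have norm: "norm1 (bits L r) = hyperbinary_count n + hyperbinary_count (n - 1)"
    using p by (simp add: mass_def)
  have "hyperbinary_count (n - 1) \<le> (L + 1) * hyperbinary_count n"
    using fold_step_comparable(2)[of "bits L r"] p by simp
  thus le: "norm1 (bits L r) \<le> (L + 2) * hyperbinary_count n"
    by (simp add: norm algebra_simps)
  show "hyperbinary_count n > 0"
    using le norm1_pos[of "bits L r"] by (cases "hyperbinary_count n") auto
  show "hyperbinary_count n \<le> norm1 (bits L r)" by (simp add: norm)
qed

lemma log_norm_close_on_good_set:
  assumes r: "r < 2 ^ L" and "\<alpha> \<ge> 0" "\<epsilon> \<ge> 0" "L \<ge> 1"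
    and close: "\<bar>ln (hyperbinary_count (2 ^ L + r)) / ln (real (2 ^ L + r)) - \<alpha>\<bar> \<le> \<epsilon>"
  shows "\<bar>ln (norm1 (bits L r)) - \<alpha> * (L * ln 2)\<bar> \<le> \<epsilon> * (real L + 1) * ln 2 + \<alpha> * ln 2 + ln (real L + 2)"
proof -
  define n where "n = 2 ^ L + r"
  note N = norm1_bits_hyperbinary[OF r, folded n_def]
  have n: "2 ^ L \<le> n" "n \<le> 2 ^ (L + 1)" using r by (simp_all add: n_def power_add)
  have n_ge: "L * ln 2 \<le> ln (real n)"
  proof -
    have "real (2 ^ L) \<le> real n" using n(1) by (rule of_nat_mono)
    hence "ln (2 ^ L) \<le> ln (real n)" by (subst ln_le_cancel_iff) (auto simp: n_def add_pos_nonneg)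
    thus ?thesis by (simp add: ln_realpow)
  qed
  have n_le: "ln (real n) \<le> (real L + 1) * ln 2"
  proof -
    have "real n \<le> real (2 ^ (L + 1))" using n(2) by (rule of_nat_mono)
    hence "ln (real n) \<le> ln (2 ^ (L + 1))" by (subst ln_le_cancel_iff) (auto simp: n_def add_pos_nonneg)
    thus ?thesis by (simp only: ln_realpow) (simp add: algebra_simps)
  qed
  have "0 < L * ln (2 :: real)" using assms(4) by simp
  hence ln_pos: "ln (real n) > 0" using n_ge by linarith
  have "ln (hyperbinary_count n) - \<alpha> * ln n = (ln (hyperbinary_count n) / ln (real n) - \<alpha>) * ln n"
    using ln_pos by (simp add: left_diff_distrib)
  hence "\<bar>ln (hyperbinary_count n) - \<alpha> * ln n\<bar> = \<bar>ln (hyperbinary_count n) / ln (real n) - \<alpha>\<bar> * ln n"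
    using ln_pos by (simp add: abs_mult)
  also have "\<dots> \<le> \<epsilon> * ln n" using close ln_pos by (intro mult_right_mono) (auto simp: n_def)
  also have "\<dots> \<le> \<epsilon> * ((real L + 1) * ln 2)" using n_le assms(3) by (intro mult_left_mono) auto
  finally have 1: "\<bar>ln (hyperbinary_count n) - \<alpha> * ln n\<bar> \<le> \<epsilon> * (real L + 1) * ln 2" by simp
  have 2: "\<alpha> * (L * ln 2) \<le> \<alpha> * ln n" "\<alpha> * ln n \<le> \<alpha> * ((real L + 1) * ln 2)"
    using n_ge n_le assms(2) by (intro mult_left_mono; simp)+
  have "real (norm1 (bits L r)) \<le> real ((L + 2) * hyperbinary_count n)" using N(3) by (rule of_nat_mono)
  hence "ln (norm1 (bits L r)) \<le> ln (real (L + 2) * real (hyperbinary_count n))"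
    using N(1) norm1_pos[of "bits L r"] by (subst ln_le_cancel_iff) (auto simp: algebra_simps)
  also have "\<dots> = ln (real L + 2) + ln (hyperbinary_count n)" using N(1) by (subst ln_mult_pos) auto
  finally have 3: "ln (norm1 (bits L r)) \<le> ln (real L + 2) + ln (hyperbinary_count n)" .
  have 4: "ln (hyperbinary_count n) \<le> ln (norm1 (bits L r))"
    using N(1,2) by simp
  have 5: "ln (real L + 2) \<ge> 0" by simp
  have "\<alpha> * ((real L + 1) * ln 2) = \<alpha> * (L * ln 2) + \<alpha> * ln 2" by (simp add: algebra_simps)
  thus ?thesis using 1 2 3 4 5 by linarith
qed

lemma ln_norm1_bounds: "0 \<le> ln (norm1 w)" "ln (norm1 w) \<le> (real (length w) + 1) * ln 2"
proof -
  show "0 \<le> ln (norm1 w)" using norm1_pos[of w] by simp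
  have "real (norm1 w) \<le> real (2 ^ Suc (length w))" using norm1_le by (rule of_nat_mono)
  hence "ln (norm1 w) \<le> ln (2 ^ Suc (length w))" using norm1_pos[of w] by (subst ln_le_cancel_iff) auto
  thus "ln (norm1 w) \<le> (real (length w) + 1) * ln 2" by (simp only: ln_realpow) (simp add: algebra_simps)
qed

definition mean_value :: "(bool list \<Rightarrow> real) \<Rightarrow> nat \<Rightarrow> real" where
  "mean_value F L = (\<Sum>r<2 ^ L. F (bits L r)) / 2 ^ L"

lemma mean_deviation_le:
  fixes f :: "nat \<Rightarrow> real"
  assumes "\<And>r. r < Q \<Longrightarrow> \<bar>f r - c\<bar> \<le> g + (if r \<in> E then h else 0)" "E \<subseteq> {..<Q}" "Q > 0"
  shows "\<bar>(\<Sum>r<Q. f r) / Q - c\<bar> \<le> g + card E / Q * h"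
proof -
  have "(\<Sum>r<Q. f r) / Q - c = (\<Sum>r<Q. f r - c) / Q"
    using assms(3) by (simp add: sum_subtractf field_simps)
  also have "\<bar>\<dots>\<bar> \<le> (\<Sum>r<Q. g + (if r \<in> E then h else 0)) / Q"
    unfolding abs_divide abs_of_nat using assms(1)
    by (intro divide_right_mono order.trans[OF sum_abs] sum_mono) auto
  also have "(\<Sum>r<Q. g + (if r \<in> E then h else 0)) = Q * g + card E * h"
    using assms(2) by (simp add: sum.distrib sum.If_cases inf.absorb2)
  finally show ?thesis using assms(3) by (simp add: add_divide_distrib)
qed

text \<open>
  Off the exceptions, \<open>log norm1\<close> differs from \<open>\<alpha> L log 2\<close> by at most \<open>\<epsilon> L log 2 + O(log L)\<close>.  On the exceptions
  the difference is \<open>O(L)\<close>, but their proportion tends to 0.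
\<close>
lemma mean_log_norm_tendsto:
  assumes "\<alpha> \<ge> 0" and dens: "has_natural_density S 1"
    and lim: "(\<lambda>k. ln (real (hyperbinary_count (enumerate S k))) / ln (real (enumerate S k))) \<longlonglongrightarrow> \<alpha>"
  shows "(\<lambda>L. mean_value (\<lambda>w. ln (norm1 w)) L / L) \<longlonglongrightarrow> \<alpha> * ln 2"
proof (rule LIMSEQ_I)
  fix e :: real assume e: "e > 0"
  define \<epsilon> where "\<epsilon> = e / 2"
  have \<epsilon>: "\<epsilon> > 0" using e by (simp add: \<epsilon>_def)
  have inf: "infinite S" using dens by (rule density_one_infinite)
  obtain K where K: "\<bar>ln (real (hyperbinary_count (enumerate S k))) / ln (real (enumerate S k)) - \<alpha>\<bar> < \<epsilon>"
    if "k \<ge> K" for k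
    using LIMSEQ_D[OF lim \<epsilon>] by auto
  define n0 where "n0 = enumerate S K"
  have good: "\<bar>ln (real (hyperbinary_count n)) / ln (real n) - \<alpha>\<bar> < \<epsilon>" if nS: "n \<in> S" and n0: "n \<ge> n0" for n
  proof -
    obtain k where k: "enumerate S k = n" using enumerate_Ex[OF inf nS] by auto
    have "k \<ge> K"
      using n0 k enumerate_mono[OF _ inf, of k K] by (auto simp: n0_def not_le[symmetric])
    from K[OF this] show ?thesis by (simp add: k)
  qed
  define b where "b L = card (exceptions S L) / 2 ^ L" for L
  have b: "b \<longlonglongrightarrow> 0" using exceptions_negligible[OF dens] by (simp add: b_def[abs_def])
  define g where "g L = (\<epsilon> * (real L + 1) * ln 2 + \<alpha> * ln 2 + ln (real L + 2)) / L
      + b L * ((real L + 1) * (1 + \<alpha>) * ln 2 / L)" for L :: nat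
  have 1: "(\<lambda>L::nat. (\<epsilon> * (real L + 1) * ln 2 + \<alpha> * ln 2 + ln (real L + 2)) / L) \<longlonglongrightarrow> \<epsilon> * ln 2"
    by real_asymp
  have 2: "(\<lambda>L::nat. (real L + 1) * (1 + \<alpha>) * ln 2 / L) \<longlonglongrightarrow> (1 + \<alpha>) * ln 2"
    by real_asymp
  have "g \<longlonglongrightarrow> \<epsilon> * ln 2 + 0 * ((1 + \<alpha>) * ln 2)"
    unfolding g_def[abs_def] by (rule tendsto_add[OF 1 tendsto_mult[OF b 2]])
  moreover have "\<epsilon> * ln 2 + 0 * ((1 + \<alpha>) * ln 2) < e"
  proof -
    have "\<epsilon> * ln 2 \<le> \<epsilon> * 1" using \<epsilon> ln_2_less_1 by (intro mult_left_mono) auto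
    thus ?thesis using e by (simp add: \<epsilon>_def)
  qed
  ultimately have "\<forall>\<^sub>F L in sequentially. g L < e" by (rule order_tendstoD)
  moreover have "\<forall>\<^sub>F L in sequentially. L \<ge> n0" "\<forall>\<^sub>F L in sequentially. L \<ge> (1::nat)"
    by (rule eventually_ge_at_top)+
  ultimately have "\<forall>\<^sub>F L in sequentially.
      norm (mean_value (\<lambda>w. ln (norm1 w)) L / L - \<alpha> * ln 2) < e"
  proof eventually_elim
    case (elim L)
    define h where "h = (real L + 1) * (1 + \<alpha>) * ln 2"
    define g1 where "g1 = \<epsilon> * (real L + 1) * ln 2 + \<alpha> * ln 2 + ln (real L + 2)"
    have g1: "g1 \<ge> 0" using \<epsilon> assms(1) by (auto simp: g1_def intro!: add_nonneg_nonneg)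
    have h0: "h \<ge> 0" using assms(1) by (simp add: h_def)
    have "\<bar>ln (norm1 (bits L r)) - \<alpha> * (L * ln 2)\<bar> \<le> g1 + (if r \<in> exceptions S L then h else 0)"
      if r: "r < 2 ^ L" for r
    proof (cases "r \<in> exceptions S L")
      case True
      have "0 \<le> \<alpha> * (L * ln 2)" "\<alpha> * (L * ln 2) \<le> \<alpha> * ((real L + 1) * ln 2)"
        using assms(1) by (auto intro!: mult_left_mono)
      moreover have "h = (real L + 1) * ln 2 + \<alpha> * ((real L + 1) * ln 2)" by (simp add: h_def algebra_simps)
      ultimately have "\<bar>ln (norm1 (bits L r)) - \<alpha> * (L * ln 2)\<bar> \<le> h"
        using ln_norm1_bounds[of "bits L r"] by simp
      thus ?thesis using True g1 by simp
    next
      case False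
      hence "2 ^ L + r \<in> S" using r by (simp add: exceptions_def)
      moreover have "n0 \<le> 2 ^ L + r"
        using elim(2) less_exp[of L] by linarith
      ultimately have "\<bar>ln (hyperbinary_count (2 ^ L + r)) / ln (real (2 ^ L + r)) - \<alpha>\<bar> \<le> \<epsilon>"
        using good[of "2 ^ L + r"] by simp
      from log_norm_close_on_good_set[OF r assms(1) _ elim(3) this] False \<epsilon> show ?thesis
        by (simp add: g1_def add_ac)
    qed
    hence "\<bar>(\<Sum>r<2 ^ L. ln (norm1 (bits L r))) / real (2 ^ L) - \<alpha> * (L * ln 2)\<bar>
        \<le> g1 + card (exceptions S L) / real (2 ^ L) * h"
      by (intro mean_deviation_le) (auto simp: exceptions_def)
    hence "\<bar>mean_value (\<lambda>w. ln (norm1 w)) L - \<alpha> * (L * ln 2)\<bar> \<le> g1 + b L * h"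
      by (simp add: mean_value_def b_def)
    hence "\<bar>mean_value (\<lambda>w. ln (norm1 w)) L - \<alpha> * (L * ln 2)\<bar> / L \<le> (g1 + b L * h) / L"
      by (intro divide_right_mono) auto
    also have "\<dots> = g L" by (simp add: g_def g1_def h_def add_divide_distrib)
    also have "\<dots> < e" by (rule elim(1))
    also have "\<bar>mean_value (\<lambda>w. ln (norm1 w)) L - \<alpha> * (L * ln 2)\<bar> / L
        = \<bar>mean_value (\<lambda>w. ln (norm1 w)) L / L - \<alpha> * ln 2\<bar>"
      using abs_diff_mult_divide[of L "mean_value (\<lambda>w. ln (norm1 w)) L" "\<alpha> * ln 2"] elim(3)
      by (simp only: mult.assoc mult.commute[of "ln 2"])
    finally show ?case by simp
  qed
  thus "\<exists>no. \<forall>L\<ge>no. norm (mean_value (\<lambda>w. ln (norm1 w)) L / L - \<alpha> * ln 2) < e"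
    by (simp add: eventually_sequentially)
qed

lemma bits_add_split:
  "bits (m + L) n = bits m (n div 2 ^ L) @ bits L (n mod 2 ^ L)"
  using bits_append[of "n mod 2 ^ L" L m "n div 2 ^ L"] by simp

lemma prefix_power: "prefix (2 ^ L) k t = prefix 2 (k * L) t"
  by (simp add: prefix_def power_mult[symmetric] mult.commute)

section \<open>Almost additive functions of the digits\<close>

definition word :: "nat \<Rightarrow> real \<Rightarrow> bool list" where
  "word m t = bits m (prefix 2 m t)"

lemma word_add:
  assumes "t \<ge> 0"
  obtains v where "length v = l" "word (m + l) t = word m t @ v"
proof
  show "word (m + l) t = word m t @ bits l (prefix 2 (m + l) t mod 2 ^ l)"
    using assms by (simp add: word_def bits_add_split prefix_add_div)
qed simp

lemma div_bounds:
  assumes "L > 0"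
  shows "real m / L - 1 \<le> real (m div L)" "real (m div L) \<le> real m / L"
proof -
  have "real m = real (m div L * L + m mod L)" by simp
  hence m: "real m = real (m div L) * L + real (m mod L)" by (simp only: of_nat_add of_nat_mult)
  have "real (m mod L) \<le> L" using assms by simp
  with m assms show "real m / L - 1 \<le> real (m div L)" "real (m div L) \<le> real m / L"
    by (simp_all add: field_simps)
qed

text \<open>
  The defect of additivity is bounded in terms of the right-hand word alone, and \<open>c\<close> is sublinear.  So if a
  long word is cut into blocks of length \<open>L\<close>, the total defect is a fraction \<open>c L / L\<close> of the length of the word,
  which is small for large \<open>L\<close>.
\<close>
locale almost_additive =
  fixes F :: "bool list \<Rightarrow> real" and c :: "nat \<Rightarrow> real" and B :: real
  assumes almost_additive: "\<bar>F (u @ v) - F u - F v\<bar> \<le> c (length v)"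
    and linear_bound: "\<bar>F v\<bar> \<le> B * (real (length v) + 1)"
    and mono_defect: "mono c"
    and small_defect: "(\<lambda>L. c L / L) \<longlonglongrightarrow> 0"
begin

lemma B_nonneg: "B \<ge> 0"
  using linear_bound[of "[]"] by simp

lemma block_decomposition:
  "\<bar>F (bits (k * L) n) - digit_sum (\<lambda>r. F (bits L r)) (2 ^ L) k n\<bar> \<le> k * c L + B"
proof (induction k arbitrary: n)
  case 0
  thus ?case using linear_bound[of "[]"] by simp
next
  case (Suc k)
  have "bits (Suc k * L) n = bits (k * L) (n div 2 ^ L) @ bits L (n mod 2 ^ L)"
    using bits_add_split[of "k * L" L n] by (simp add: add.commute)
  moreover have "\<bar>F (bits (k * L) (n div 2 ^ L) @ bits L (n mod 2 ^ L)) - F (bits (k * L) (n div 2 ^ L))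
      - F (bits L (n mod 2 ^ L))\<bar> \<le> c L"
    using almost_additive[of "bits (k * L) (n div 2 ^ L)" "bits L (n mod 2 ^ L)"] by simp
  ultimately show ?case using Suc[of "n div 2 ^ L"] by (simp add: algebra_simps)
qed

text \<open>
  The last, incomplete block of the word costs only a constant that depends on \<open>L\<close>.
\<close>
lemma word_block_approximation:
  assumes "t \<in> {0..<1}" "L \<ge> 1"
  shows "\<bar>F (word m t) - digit_sum (\<lambda>r. F (bits L r)) (2 ^ L) (m div L) (prefix (2 ^ L) (m div L) t)\<bar>
           \<le> real (m div L) * c L + (c L + B * (L + 2))"
proof -
  define k where "k = m div L"
  obtain v where v: "length v = m mod L" "word (k * L + m mod L) t = word (k * L) t @ v"
    using word_add[of t "m mod L" "k * L"] assms(1) by auto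
  have lt: "m mod L < L" using assms(2) by simp
  have "\<bar>F (word m t) - F (word (k * L) t) - F v\<bar> \<le> c (m mod L)"
    using almost_additive[of "word (k * L) t" v] v by (simp add: k_def)
  also have "\<dots> \<le> c L" using lt by (intro monoD[OF mono_defect]) simp
  finally have 1: "\<bar>F (word m t) - F (word (k * L) t) - F v\<bar> \<le> c L" .
  have "\<bar>F v\<bar> \<le> B * (real (m mod L) + 1)" using linear_bound[of v] v(1) by simp
  also have "\<dots> \<le> B * (real L + 1)"
    using lt B_nonneg by (intro mult_left_mono) auto
  finally have 2: "\<bar>F v\<bar> \<le> B * (real L + 1)" .
  have 3: "\<bar>F (word (k * L) t) - digit_sum (\<lambda>r. F (bits L r)) (2 ^ L) k (prefix (2 ^ L) k t)\<bar> \<le> k * c L + B"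
    using block_decomposition[of k L "prefix 2 (k * L) t"] by (simp add: word_def prefix_power)
  have "B * (real L + 2) = B * (real L + 1) + B" by (simp add: algebra_simps)
  thus ?thesis using 1 2 3 unfolding k_def[symmetric] by (simp add: add.commute)
qed

text \<open>
  The assumption \<open>typical\<close> asks for the law of large numbers for blocks of every length \<open>L\<close>, because \<open>L\<close>
  is chosen only after the accuracy \<open>e\<close>.
\<close>
lemma tendsto_mean_along_word:
  assumes mean: "(\<lambda>L. mean_value F L / L) \<longlonglongrightarrow> \<mu>" and t: "t \<in> {0..<1}"
    and typical: "\<And>L. (\<lambda>k. digit_sum (\<lambda>r. F (bits L r)) (2 ^ L) k (prefix (2 ^ L) k t) / k) \<longlonglongrightarrow> mean_value F L"
  shows "(\<lambda>m. F (word m t) / m) \<longlonglongrightarrow> \<mu>"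
proof (rule LIMSEQ_I)
  fix e :: real assume e: "e > 0"
  have "\<forall>\<^sub>F L in sequentially. \<bar>mean_value F L / L - \<mu>\<bar> < e / 4"
    using tendstoD[OF mean, of "e / 4"] e by (simp add: dist_real_def)
  moreover have "\<forall>\<^sub>F L in sequentially. \<bar>c L / L\<bar> < e / 4"
    using tendstoD[OF small_defect, of "e / 4"] e by (simp add: dist_real_def)
  ultimately have "\<forall>\<^sub>F L in sequentially. \<bar>mean_value F L / L - \<mu>\<bar> < e / 4 \<and> \<bar>c L / L\<bar> < e / 4 \<and> L \<ge> 1"
    using eventually_ge_at_top[of 1] by eventually_elim auto
  then obtain L where L: "\<bar>mean_value F L / L - \<mu>\<bar> < e / 4" "\<bar>c L / L\<bar> < e / 4" "L \<ge> 1"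
    using eventually_happens'[OF sequentially_bot] by blast
  define D where "D k = digit_sum (\<lambda>r. F (bits L r)) (2 ^ L) k (prefix (2 ^ L) k t)" for k
  define K where "K = c L + B * (L + 2)"
  have div_top: "filterlim (\<lambda>m. m div L) at_top sequentially"
    using L(3) by (intro filterlim_at_top_div_const_nat) simp
  have div_lim: "(\<lambda>m. real (m div L) / m) \<longlonglongrightarrow> 1 / L"
  proof (rule tendsto_sandwich)
    show "\<forall>\<^sub>F m in sequentially. 1 / L - 1 / m \<le> real (m div L) / m"
      using eventually_gt_at_top[of 0]
    proof eventually_elim
      case (elim m)
      have "real m / L - 1 \<le> real (m div L)" using div_bounds(1)[of L m] L(3) by simp
      hence "(real m / L - 1) / m \<le> real (m div L) / m" by (intro divide_right_mono) auto
      thus ?case using elim by (simp add: diff_divide_distrib)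
    qed
    show "\<forall>\<^sub>F m in sequentially. real (m div L) / m \<le> 1 / L"
      using eventually_gt_at_top[of 0]
    proof eventually_elim
      case (elim m)
      have "real (m div L) / m \<le> (real m / L) / m"
        using div_bounds(2)[of L m] L(3) by (intro divide_right_mono) auto
      thus ?case using elim by simp
    qed
    show "(\<lambda>m. 1 / real L - 1 / real m) \<longlonglongrightarrow> 1 / L" by real_asymp
  qed simp
  have "(\<lambda>m. D (m div L) / real (m div L)) \<longlonglongrightarrow> mean_value F L"
    using filterlim_compose[OF typical[of L] div_top] by (simp add: D_def)
  hence "(\<lambda>m. D (m div L) / real (m div L) * (real (m div L) / m)) \<longlonglongrightarrow> mean_value F L * (1 / L)"
    by (intro tendsto_mult div_lim)
  moreover have "(\<lambda>m. D (m div L) / real (m div L) * (real (m div L) / m)) = (\<lambda>m. D (m div L) / m)"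
  proof
    show "D (m div L) / real (m div L) * (real (m div L) / m) = D (m div L) / m" for m
      by (cases "m div L = 0") (simp_all add: D_def)
  qed
  ultimately have lim: "(\<lambda>m. D (m div L) / m) \<longlonglongrightarrow> mean_value F L / L" by (simp only: mult_1_right times_divide_eq_right)
  have K: "(\<lambda>m. K / real m) \<longlonglongrightarrow> 0" by real_asymp
  have "\<forall>\<^sub>F m in sequentially. \<bar>D (m div L) / m - mean_value F L / L\<bar> < e / 4"
    using tendstoD[OF lim, of "e / 4"] e by (simp add: dist_real_def)
  moreover have "\<forall>\<^sub>F m in sequentially. \<bar>K / real m\<bar> < e / 4"
    using tendstoD[OF K, of "e / 4"] e by (simp add: dist_real_def)
  ultimately have "\<forall>\<^sub>F m in sequentially. norm (F (word m t) / m - \<mu>) < e"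
    using eventually_gt_at_top[of 0]
  proof eventually_elim
    case (elim m)
    have "0 \<le> c L" using monoD[OF mono_defect, of 0 L] almost_additive[of "[]" "[]"] by simp
    hence "real (m div L) * c L \<le> real m / L * c L"
      using div_bounds(2)[of L m] L(3) by (intro mult_right_mono) auto
    hence "\<bar>F (word m t) - D (m div L)\<bar> \<le> m * (c L / L) + K"
      using word_block_approximation[OF t L(3), of m] by (simp add: D_def K_def)
    hence "\<bar>F (word m t) - D (m div L)\<bar> / m \<le> (m * (c L / L) + K) / m"
      by (intro divide_right_mono) auto
    also have "\<dots> = c L / L + K / m" using elim by (simp add: add_divide_distrib)
    also have "\<bar>F (word m t) - D (m div L)\<bar> / m = \<bar>F (word m t) / m - D (m div L) / m\<bar>"
      by (simp flip: diff_divide_distrib)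
    finally have "\<bar>F (word m t) / m - D (m div L) / m\<bar> \<le> c L / L + K / m" .
    thus ?case unfolding real_norm_def using elim(1,2) L(1,2) by linarith
  qed
  thus "\<exists>no. \<forall>m\<ge>no. norm (F (word m t) / m - \<mu>) < e" by (simp add: eventually_sequentially)
qed

theorem AE_tendsto_mean:
  assumes "(\<lambda>L. mean_value F L / L) \<longlonglongrightarrow> \<mu>"
  shows "AE t in lborel. t \<in> {0..<1} \<longrightarrow> (\<lambda>m. F (word m t) / m) \<longlonglongrightarrow> \<mu>"
proof -
  have "AE t in lborel. t \<in> {0..<1} \<longrightarrow>
     (\<lambda>k. digit_sum (\<lambda>r. F (bits L r)) (2 ^ L) k (prefix (2 ^ L) k t) / k) \<longlonglongrightarrow> mean_value F L" for L
    using AE_digit_average[of "2 ^ L" "\<lambda>r. F (bits L r)"] by (simp add: mean_value_def)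
  hence "AE t in lborel. \<forall>L. t \<in> {0..<1} \<longrightarrow>
     (\<lambda>k. digit_sum (\<lambda>r. F (bits L r)) (2 ^ L) k (prefix (2 ^ L) k t) / k) \<longlonglongrightarrow> mean_value F L"
    by (subst AE_all_countable) blast
  thus ?thesis
    by (rule AE_mp, intro AE_I2 impI) (rule tendsto_mean_along_word[OF assms], auto)
qed

end

section \<open>Two almost additive functions: logarithmic norm and number of changes\<close>

interpretation log_norm: almost_additive "\<lambda>w. ln (norm1 w)" "\<lambda>l. ln (2 * (real l + 2))" "ln 2"
proof
  show "\<bar>ln (norm1 (u @ v)) - ln (norm1 u) - ln (norm1 v)\<bar> \<le> ln (2 * (real (length v) + 2))" for u v
  proof -
    have pos: "real (norm1 w) > 0" for w using norm1_pos[of w] by simp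
    have "real (norm1 (u @ v)) \<le> real (norm1 u * norm1 v)" using mass_submult by (rule of_nat_mono)
    hence "ln (norm1 (u @ v)) \<le> ln (real (norm1 u) * real (norm1 v))"
      using pos by (subst ln_le_cancel_iff) auto
    also have "\<dots> = ln (norm1 u) + ln (norm1 v)" using pos by (subst ln_mult_pos) auto
    finally have 1: "ln (norm1 (u @ v)) \<le> ln (norm1 u) + ln (norm1 v)" .
    have "real (norm1 u * norm1 v) \<le> real (2 * (length v + 2) * norm1 (u @ v))"
      using mass_supermult by (rule of_nat_mono)
    hence "ln (real (norm1 u) * real (norm1 v)) \<le> ln (2 * (real (length v) + 2) * real (norm1 (u @ v)))"
      using pos by (subst ln_le_cancel_iff) (auto simp: algebra_simps intro!: add_pos_nonneg)
    hence "ln (norm1 u) + ln (norm1 v) \<le> ln (2 * (real (length v) + 2)) + ln (norm1 (u @ v))"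
      using pos by (simp add: ln_mult_pos)
    moreover have "0 \<le> ln (2 * (real (length v) + 2))" by simp
    ultimately show ?thesis using 1 by linarith
  qed
  show "\<bar>ln (norm1 v)\<bar> \<le> ln 2 * (real (length v) + 1)" for v
    using ln_norm1_bounds[of v] by (simp add: mult.commute)
  show "mono (\<lambda>l. ln (2 * (real l + 2)))" by (rule monoI) simp
  show "(\<lambda>L. ln (2 * (real L + 2)) / L) \<longlonglongrightarrow> 0" by real_asymp
qed

fun changes :: "bool list \<Rightarrow> nat" where
  "changes (x # y # zs) = (if x \<noteq> y then 1 else 0) + changes (y # zs)"
| "changes _ = 0"

lemma changes_append:
  assumes "u \<noteq> []" "v \<noteq> []"
  shows "changes (u @ v) = changes u + (if last u \<noteq> hd v then 1 else 0) + changes v"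
  using assms
proof (induction u rule: changes.induct)
  case ("2_2" x)
  thus ?case by (cases v) auto
qed auto

lemma changes_le: "changes v \<le> length v"
  by (induction v rule: changes.induct) auto

interpretation change_count: almost_additive "\<lambda>w. real (changes w)" "\<lambda>_. 1" 1
proof
  show "\<bar>real (changes (u @ v)) - real (changes u) - real (changes v)\<bar> \<le> 1" for u v
    by (cases "u = [] \<or> v = []") (auto simp: changes_append)
  show "\<bar>real (changes v)\<bar> \<le> 1 * (real (length v) + 1)" for v
    using changes_le[of v] by simp
  show "mono (\<lambda>_. 1 :: real)" by (rule monoI) simp
  show "(\<lambda>L. 1 / real L) \<longlonglongrightarrow> 0" by real_asymp
qed

text \<open>
  Appending a uniformly random digit to a nonempty word creates a change with probability \<open>1 / 2\<close>.
\<close>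
lemma mean_changes: "mean_value (\<lambda>w. real (changes w)) (Suc L) = L / 2"
proof (induction L)
  case 0
  have "bits (Suc 0) n = [odd n]" for n by simp
  thus ?case by (simp add: mean_value_def numeral_2_eq_2)
next
  case (Suc L)
  let ?f = "\<lambda>m r. real (changes (bits m r))"
  have "(\<Sum>c<2. ?f (Suc (Suc L)) (r * 2 + c)) = 2 * ?f (Suc L) r + 1" for r
  proof -
    have ne: "bits (Suc L) r \<noteq> []" by simp
    have "bits (Suc (Suc L)) (r * 2) = bits (Suc L) r @ [False]"
      "bits (Suc (Suc L)) (r * 2 + 1) = bits (Suc L) r @ [True]"
      by (simp_all del: bits.simps add: bits.simps(2)[of "Suc L"])
    thus ?thesis using changes_append[OF ne]
      by (simp add: numeral_2_eq_2 One_nat_def del: bits.simps)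
  qed
  hence "(\<Sum>r<2 ^ Suc L * 2. ?f (Suc (Suc L)) r) = (\<Sum>r<2 ^ Suc L. 2 * ?f (Suc L) r + 1)"
    unfolding sum_lessThan_mult by (intro sum.cong refl)
  also have "\<dots> = 2 * (\<Sum>r<2 ^ Suc L. ?f (Suc L) r) + 2 ^ Suc L"
    by (simp add: sum.distrib sum_distrib_left del: bits.simps)
  finally have "mean_value (\<lambda>w. real (changes w)) (Suc (Suc L)) = mean_value (\<lambda>w. real (changes w)) (Suc L) + 1 / 2"
    by (simp add: mean_value_def mult.commute add_divide_distrib del: bits.simps)
  thus ?case using Suc by (simp add: field_simps)
qed

lemma mean_changes_tendsto: "(\<lambda>L. mean_value (\<lambda>w. real (changes w)) L / L) \<longlonglongrightarrow> 1 / 2"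
proof (subst filterlim_sequentially_Suc[symmetric])
  have "(\<lambda>L::nat. real L / 2 / (real L + 1)) \<longlonglongrightarrow> 1 / 2" by real_asymp
  thus "(\<lambda>L. mean_value (\<lambda>w. real (changes w)) (Suc L) / real (Suc L)) \<longlonglongrightarrow> 1 / 2"
    by (simp add: mean_changes add.commute)
qed

section \<open>Continued fractions and blocks of digits\<close>

text \<open>
  The continuants of \<open>as\<close> and of its tail, that is, denominator and numerator of the continued fraction \<open>[0; as]\<close>.
\<close>
fun continuants :: "nat list \<Rightarrow> nat \<times> nat" where
  "continuants [] = (1, 0)"
| "continuants (a # as) = (a * fst (continuants as) + snd (continuants as), fst (continuants as))"

lemma continuants_cfrac:
  assumes "\<forall>a\<in>set as. a \<ge> 1"
  shows "fst (continuants as) > 0 \<and> coprime (snd (continuants as)) (fst (continuants as)) \<and>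
         snd (continuants as) \<le> fst (continuants as) \<and>
         cfrac as = of_nat (snd (continuants as)) / of_nat (fst (continuants as))"
  using assms
proof (induction as)
  case (Cons a as)
  define q p where "q = fst (continuants as)" and "p = snd (continuants as)"
  have IH: "q > 0" "coprime p q" "cfrac as = of_nat p / of_nat q"
    using Cons by (simp_all add: q_def p_def)
  have a: "a \<ge> 1" using Cons.prems by simp
  hence "q \<le> a * q" by simp
  hence "q \<le> a * q + p" by linarith
  moreover have "coprime q (a * q + p)"
    using IH(2) by (metis coprime_commute gcd_add_mult coprime_iff_gcd_eq_1 mult.commute add.commute)
  moreover have "cfrac (a # as) = of_nat q / of_nat (a * q + p)"
  proof -
    have "of_nat a + of_nat p / of_nat q = (of_nat (a * q + p) / of_nat q :: rat)"
      using IH(1) by (simp add: add_divide_distrib)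
    thus ?thesis by (simp add: IH(3))
  qed
  ultimately show ?case using IH(1) a by (simp add: q_def p_def)
qed simp

lemma convergent_denom_eq_continuant:
  assumes "\<forall>j. a j \<ge> 1"
  shows "convergent_denom a s = int (fst (continuants (map a [0..<s])))"
proof -
  let ?q = "fst (continuants (map a [0..<s]))" and ?p = "snd (continuants (map a [0..<s]))"
  have *: "?q > 0" "coprime ?p ?q" "cfrac (map a [0..<s]) = of_nat ?p / of_nat ?q"
    using continuants_cfrac[of "map a [0..<s]"] assms by auto
  hence "cfrac (map a [0..<s]) = Fract (int ?p) (int ?q)"
    by (simp add: Fract_of_int_quotient)
  moreover have "Rat.normalize (int ?p, int ?q) = (int ?p, int ?q)"
    using * by (intro normalize_stable) auto
  ultimately show ?thesis by (simp add: convergent_denom_def quotient_of_Fract)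
qed

fun blocks :: "bool \<Rightarrow> nat list \<Rightarrow> bool list" where
  "blocks d [] = []"
| "blocks d (a # as) = replicate a d @ blocks (\<not> d) as"

lemma blocks_snoc:
  "blocks d (as @ [a]) = blocks d as @ replicate a (if even (length as) then d else \<not> d)"
  by (induction as arbitrary: d) auto

lemma changes_replicate: "changes (replicate n d) = 0"
proof (induction n)
  case (Suc n)
  thus ?case by (cases n) auto
qed simp

lemma changes_blocks:
  assumes "\<forall>a\<in>set as. a \<ge> 1" "as \<noteq> []"
  shows "Suc (changes (blocks d as)) = length as"
  using assms
proof (induction as arbitrary: d)
  case (Cons a as)
  have a: "a \<ge> 1" using Cons.prems by simp
  show ?case
  proof (cases as)
    case Nil
    thus ?thesis by (simp add: changes_replicate)
  next
    case (Cons b bs)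
    have b: "b \<ge> 1" using Cons.prems \<open>as = b # bs\<close> by simp
    have ne: "replicate a d \<noteq> []" "blocks (\<not> d) as \<noteq> []"
      using a b \<open>as = b # bs\<close> by auto
    have "hd (blocks (\<not> d) as) = (\<not> d)" using b \<open>as = b # bs\<close> by (cases b) auto
    moreover have "last (replicate a d) = d" using a by simp
    ultimately have "changes (blocks d (a # as)) = Suc (changes (blocks (\<not> d) as))"
      using changes_append[OF ne] by (simp add: changes_replicate)
    thus ?thesis using Cons.IH[of "\<not> d"] Cons.prems \<open>as = b # bs\<close> by simp
  qed
qed simp

text \<open>
  The unit vector whose column sum grows when the digit \<open>d\<close> is prepended.
\<close>
definition unit_pair :: "bool \<Rightarrow> nat \<times> nat" where
  "unit_pair d = (if d then (1, 0) else (0, 1))"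

lemma norm1_eq_columns: "norm1 w = mass w (unit_pair d) + mass w (unit_pair (\<not> d))"
  using mass_linear[of w 1 1] by (simp add: unit_pair_def)

lemma mass_replicate:
  "mass (replicate a d @ v) (unit_pair d) = mass v (unit_pair d) + a * mass v (unit_pair (\<not> d))"
  "mass (replicate a d @ v) (unit_pair (\<not> d)) = mass v (unit_pair (\<not> d))"
proof -
  have T: "mass (replicate a True @ v) (x, y) = mass v (x, y + a * x)" for x y
    by (induction a arbitrary: y) (simp_all add: mass_Cons step_def algebra_simps)
  have F: "mass (replicate a False @ v) (x, y) = mass v (x + a * y, y)" for x y
    by (induction a arbitrary: x) (simp_all add: mass_Cons step_def algebra_simps)
  show "mass (replicate a d @ v) (unit_pair d) = mass v (unit_pair d) + a * mass v (unit_pair (\<not> d))"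
    using mass_linear[of v 1 a] mass_linear[of v a 1] by (cases d) (simp_all add: unit_pair_def T F)
  show "mass (replicate a d @ v) (unit_pair (\<not> d)) = mass v (unit_pair (\<not> d))"
    by (cases d) (simp_all add: unit_pair_def T F)
qed

text \<open>
  Prepending a block of \<open>a\<close> equal digits changes the column sums exactly as the entry \<open>a\<close> changes
  the continuants, except that the roles of the columns alternate with the digit.  The start values are
  \<open>(1, 1)\<close> for the empty word and \<open>(1, 0)\<close> for the continuants.  After the first block they are \<open>(a + 1, 1)\<close> and
  \<open>(a, 1)\<close>, which agree up to a factor 2, and the linear recursion preserves this.  The
  empty list has to be excluded only for the second column, where \<open>1 \<le> 2 * 0\<close> fails.
\<close>
lemma mass_blocks_continuants:
  assumes "\<forall>a\<in>set as. a \<ge> 1"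
  shows "fst (continuants as) \<le> mass (blocks d as) (unit_pair d) \<and>
         mass (blocks d as) (unit_pair d) \<le> 2 * fst (continuants as) \<and>
         (as \<noteq> [] \<longrightarrow> mass (blocks d as) (unit_pair (\<not> d)) \<le> 2 * snd (continuants as)) \<and>
         snd (continuants as) \<le> mass (blocks d as) (unit_pair (\<not> d))"
  using assms
proof (induction as arbitrary: d)
  case Nil
  show ?case by (simp add: unit_pair_def)
next
  case (Cons a as)
  define g h where "g = mass (blocks (\<not> d) as) (unit_pair (\<not> d))" and "h = mass (blocks (\<not> d) as) (unit_pair d)"
  define q p where "q = fst (continuants as)" and "p = snd (continuants as)"
  have IH: "q \<le> g" "g \<le> 2 * q" "as \<noteq> [] \<Longrightarrow> h \<le> 2 * p" "p \<le> h"
    using Cons.IH[of "\<not> d"] Cons.prems by (auto simp: g_def h_def q_def p_def)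
  have new: "mass (blocks d (a # as)) (unit_pair d) = h + a * g"
    "mass (blocks d (a # as)) (unit_pair (\<not> d)) = g"
    by (simp_all add: mass_replicate g_def h_def)
  have "a * q \<le> a * g" using IH(1) by (rule mult_left_mono) simp
  hence "a * q + p \<le> h + a * g" using IH(4) by linarith
  moreover have "h + a * g \<le> 2 * (a * q + p)"
  proof (cases "as = []")
    case True
    hence "h = 1" "g = 1" "q = 1" by (auto simp: g_def h_def q_def unit_pair_def)
    thus ?thesis using Cons.prems by simp
  next
    case False
    have "a * g \<le> a * (2 * q)" using IH(2) by (intro mult_left_mono) auto
    thus ?thesis using IH(3)[OF False] unfolding distrib_left by linarith
  qed
  ultimately show ?case using IH unfolding new by (simp flip: q_def p_def)
qed

lemma norm1_blocks_bounds:
  assumes "\<forall>a\<in>set as. a \<ge> 1"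
  shows "fst (continuants as) \<le> norm1 (blocks d as)" "norm1 (blocks d as) \<le> 4 * fst (continuants as)"
proof -
  note * = mass_blocks_continuants[OF assms, of d]
  show "fst (continuants as) \<le> norm1 (blocks d as)"
    using * by (simp add: norm1_eq_columns[of _ d])
  show "norm1 (blocks d as) \<le> 4 * fst (continuants as)"
  proof (cases "as = []")
    case True
    thus ?thesis by simp
  next
    case False
    thus ?thesis using * continuants_cfrac[OF assms] by (simp add: norm1_eq_columns[of _ d])
  qed
qed


section \<open>Block expansions of real numbers\<close>

definition digit :: "real \<Rightarrow> nat \<Rightarrow> bool" where
  "digit t i = odd (prefix 2 (Suc i) t)"

lemma prefix_Suc:
  assumes "t \<ge> 0"
  shows "prefix 2 (Suc m) t = 2 * prefix 2 m t + of_bool (digit t m)"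
proof -
  have "prefix 2 (m + 1) t div 2 ^ 1 = prefix 2 m t" using assms by (intro prefix_add_div) auto
  hence "prefix 2 (Suc m) t div 2 = prefix 2 m t" by (simp only: Suc_eq_plus1 power_one_right)
  thus ?thesis unfolding digit_def by (auto elim: oddE)
qed

lemma word_eq_map_digit:
  assumes "t \<ge> 0"
  shows "word m t = map (digit t) [0..<m]"
proof (induction m)
  case (Suc m)
  have "prefix 2 (Suc m) t div 2 = prefix 2 m t" using prefix_Suc[OF assms, of m] by simp
  thus ?case using Suc by (simp add: word_def digit_def)
qed (simp add: word_def)

lemma digit_sums:
  assumes "t \<in> {0..<1}"
  shows "(\<lambda>i. of_bool (digit t i) / 2 ^ Suc i) sums t"
proof -
  have t: "t \<ge> 0" using assms by simp
  have partial: "(\<Sum>i<m. of_bool (digit t i) / 2 ^ Suc i) = prefix 2 m t / 2 ^ m" for m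
  proof (induction m)
    case 0
    have "prefix 2 0 t = 0" using prefix_less[OF assms, of 2 0] by simp
    thus ?case by simp
  next
    case (Suc m)
    thus ?case by (simp add: prefix_Suc[OF t] field_simps)
  qed
  have "(\<lambda>m. prefix 2 m t / 2 ^ m) \<longlonglongrightarrow> t"
  proof (rule tendsto_sandwich)
    have *: "real (prefix 2 m t) \<le> 2 ^ m * t \<and> 2 ^ m * t < real (prefix 2 m t) + 1" for m
      using prefix_eq_iff[OF t, of 2 m] by auto
    show "\<forall>\<^sub>F m in sequentially. prefix 2 m t / 2 ^ m \<le> t"
      using * by (simp add: field_simps)
    show "\<forall>\<^sub>F m in sequentially. t - (1 / 2) ^ m \<le> prefix 2 m t / 2 ^ m"
    proof (rule always_eventually, rule allI)
      fix m
      have "t - (1 / 2) ^ m = (2 ^ m * t - 1) / 2 ^ m" by (simp add: field_simps power_divide)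
      also have "\<dots> \<le> prefix 2 m t / 2 ^ m" using *[of m] by (intro divide_right_mono) auto
      finally show "t - (1 / 2) ^ m \<le> prefix 2 m t / 2 ^ m" .
    qed
    show "(\<lambda>m. t - (1 / 2) ^ m) \<longlonglongrightarrow> t" by real_asymp
  qed simp
  thus ?thesis unfolding sums_def partial .
qed

lemma half_power_sums: "(\<lambda>i. 1 / 2 ^ Suc (i + m) :: real) sums (1 / 2 ^ m)"
proof -
  have "(\<lambda>i. (1 / 2 :: real) ^ Suc i * (1 / 2 ^ m)) sums (1 * (1 / 2 ^ m))"
    by (intro sums_mult2 power_half_series)
  thus ?thesis by (simp add: power_divide power_add mult.assoc)
qed

text \<open>
  The only ambiguity of binary expansions comes from expansions that are eventually 1.  A later digit 0
  makes the tail of the series strictly smaller than \<open>1 / 2\<^sup>m\<close>.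
\<close>
lemma digit_unique:
  assumes sums: "(\<lambda>i. of_bool (d i) / 2 ^ Suc i) sums t" and zeros: "\<And>m. \<exists>i\<ge>m. \<not> d i"
  shows "digit t = d"
proof -
  define V where "V = rec_nat 0 (\<lambda>m v. 2 * v + of_bool (d m) :: nat)"
  have V [simp]: "V 0 = 0" "V (Suc m) = 2 * V m + of_bool (d m)" for m by (simp_all add: V_def)
  have partial: "(\<Sum>i<m. of_bool (d i) / 2 ^ Suc i) = V m / 2 ^ m" for m
    by (induction m) (simp_all add: field_simps)
  have t: "V m / 2 ^ m \<le> t \<and> t < V m / 2 ^ m + 1 / 2 ^ m" for m
  proof -
    let ?f = "\<lambda>i. of_bool (d (i + m)) / 2 ^ Suc (i + m) :: real"
    let ?g = "\<lambda>i. 1 / 2 ^ Suc (i + m) - ?f i :: real"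
    have tail: "?f sums (t - V m / 2 ^ m)"
      using sums_split_initial_segment[OF sums, of m] by (simp only: partial)
    have "0 \<le> t - V m / 2 ^ m"
      by (rule sums_le[OF _ sums_zero tail]) simp
    moreover have gap: "?g sums (1 / 2 ^ m - (t - V m / 2 ^ m))"
      by (intro sums_diff half_power_sums tail)
    obtain i where i: "i \<ge> m" "\<not> d i" using zeros by blast
    have "0 < suminf ?g"
      by (rule suminf_pos2[of _ "i - m"]) (use gap i in \<open>auto simp: sums_iff\<close>)
    hence "0 < 1 / 2 ^ m - (t - V m / 2 ^ m)" using gap by (simp add: sums_iff)
    ultimately show ?thesis by linarith
  qed
  have "t \<ge> 0" using t[of 0] by simp
  hence "prefix 2 m t = V m" for m
    using t[of m] by (subst prefix_eq_iff) (auto simp: field_simps)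
  thus ?thesis by (simp add: digit_def fun_eq_iff)
qed

definition block_start :: "(nat \<Rightarrow> nat) \<Rightarrow> nat \<Rightarrow> nat" where
  "block_start a j = (\<Sum>l<j. a l)"

lemma block_start_simps [simp]:
  "block_start a 0 = 0" "block_start a (Suc j) = block_start a j + a j"
  by (simp_all add: block_start_def)

lemma block_start_strict_mono:
  assumes "\<forall>j. a j \<ge> 1"
  shows "strict_mono (block_start a)"
  unfolding strict_mono_Suc_iff using assms by (simp add: Suc_le_eq One_nat_def)

lemma block_digit_eq:
  assumes "\<forall>j. a j \<ge> 1" and i: "block_start a j \<le> i" "i < block_start a (Suc j)"
  shows "block_digit a i = of_bool (even j)"
proof -
  have "k = j" if k: "block_start a k \<le> i" "i < block_start a (Suc k)" for k
  proof -
    have "block_start a k < block_start a (Suc j)" "block_start a j < block_start a (Suc k)"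
      using i k by linarith+
    hence "k < Suc j" "j < Suc k"
      using strict_mono_less[OF block_start_strict_mono[OF assms(1)]] by blast+
    thus ?thesis by simp
  qed
  hence "(\<exists>k. even k \<and> block_start a k \<le> i \<and> i < block_start a (Suc k)) \<longleftrightarrow> even j"
    using i by blast
  thus ?thesis unfolding block_digit_def block_start_def[symmetric] by simp
qed

lemma map_block_digit:
  assumes "\<forall>j. a j \<ge> 1"
  shows "map (\<lambda>i. block_digit a i = 1) [0..<block_start a s] = blocks True (map a [0..<s])"
proof (induction s)
  case (Suc s)
  have "map (\<lambda>i. block_digit a i = 1) [block_start a s..<block_start a (Suc s)] = replicate (a s) (even s)"
    by (rule nth_equalityI) (auto simp: block_digit_eq[OF assms, of s])
  moreover have "[0..<block_start a (Suc s)] = [0..<block_start a s] @ [block_start a s..<block_start a (Suc s)]"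
    using upt_add_eq_append[of 0 "block_start a s" "a s"] by simp
  ultimately show ?case using Suc by (simp add: blocks_snoc del: block_start_simps)
qed simp

lemma block_digit_01: "block_digit a i = of_bool (block_digit a i = 1)"
  by (simp add: block_digit_def)

lemma block_digit_zeros:
  assumes "\<forall>j. a j \<ge> 1"
  shows "\<exists>i\<ge>m. block_digit a i \<noteq> 1"
proof (intro exI conjI)
  have "2 * m + 1 \<le> block_start a (2 * m + 1)"
    by (rule strict_mono_imp_increasing[OF block_start_strict_mono[OF assms]])
  thus "m \<le> block_start a (2 * m + 1)" by linarith
  have "block_digit a (block_start a (2 * m + 1)) = of_bool (even (2 * m + 1))"
  proof (rule block_digit_eq[OF assms])
    have "a (2 * m + 1) \<ge> 1" using assms by blast
    thus "block_start a (2 * m + 1) < block_start a (Suc (2 * m + 1))"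
      unfolding block_start_simps by linarith
  qed simp
  thus "block_digit a (block_start a (2 * m + 1)) \<noteq> 1" by simp
qed

lemma block_expansion_digit:
  assumes "block_expansion t a"
  shows "digit t = (\<lambda>i. block_digit a i = 1)"
proof (rule digit_unique)
  have "(\<lambda>i. real (block_digit a i) / 2 ^ Suc i) sums t"
    using assms by (simp add: block_expansion_def)
  moreover have "real (block_digit a i) = of_bool (block_digit a i = 1)" for i
    by (subst block_digit_01) simp
  ultimately show "(\<lambda>i. of_bool (block_digit a i = 1) / 2 ^ Suc i) sums t" by simp
  show "\<exists>i\<ge>m. block_digit a i \<noteq> 1" for m
    using assms by (intro block_digit_zeros) (simp add: block_expansion_def)
qed

text \<open>
  At the first place where the lengths differ, one expansion has already changed its digit after the shorter block,
  while the other one is still inside its block.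
\<close>
lemma block_lengths_unique:
  assumes a: "\<forall>j. a j \<ge> 1" and b: "\<forall>j. b j \<ge> 1" and eq: "\<And>i. block_digit a i = block_digit b i"
  shows "a = b"
proof -
  have not_less: "\<not> a j < b j"
    if a: "\<forall>j. a j \<ge> 1" and b: "\<forall>j. b j \<ge> 1" and eq: "\<And>i. block_digit a i = block_digit b i"
      and start: "block_start a j = block_start b j" for a b j
  proof
    assume "a j < b j"
    hence "block_digit b (block_start a (Suc j)) = of_bool (even j)"
      using start by (intro block_digit_eq[OF b]) auto
    moreover have "a (Suc j) > 0" using a by (simp add: Suc_le_eq One_nat_def)
    hence "block_digit a (block_start a (Suc j)) = of_bool (even (Suc j))"
      by (intro block_digit_eq[OF a]) simp_all
    ultimately show False using eq[of "block_start a (Suc j)"] by (cases "even j") simp_all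
  qed
  have start: "block_start a j = block_start b j" for j
  proof (induction j)
    case (Suc j)
    have "\<not> a j < b j" using not_less[OF a b eq Suc] .
    moreover have "\<not> b j < a j" using not_less[OF b a eq[symmetric] Suc[symmetric]] .
    ultimately show ?case using Suc by simp
  qed simp
  show ?thesis
  proof
    fix j
    show "a j = b j" using start[of j] start[of "Suc j"] by simp
  qed
qed

text \<open>
  The blocks end exactly at the positions where the digit changes.
\<close>
lemma block_lengths_exist:
  assumes d0: "d 0" and inf: "infinite {i. d i \<noteq> d (Suc i)}"
  shows "\<exists>a. (\<forall>j. a j \<ge> 1) \<and> (\<forall>i. block_digit a i = of_bool (d i))"
proof -
  define e where "e = enumerate {i. d i \<noteq> d (Suc i)}"
  have mono: "strict_mono e" unfolding e_def by (rule strict_mono_enumerate[OF inf])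
  have range: "range e = {i. d i \<noteq> d (Suc i)}" unfolding e_def by (rule range_enumerate[OF inf])
  define A where "A j = (case j of 0 \<Rightarrow> 0 | Suc k \<Rightarrow> Suc (e k))" for j
  have A [simp]: "A 0 = 0" "A (Suc k) = Suc (e k)" for k by (simp_all add: A_def)
  have A_less: "A j < A (Suc j)" for j
    using strict_monoD[OF mono] by (cases j) auto
  define a where "a j = A (Suc j) - A j" for j
  have a: "\<forall>j. a j \<ge> 1" using A_less by (simp add: a_def Suc_le_eq One_nat_def del: A)
  have start: "block_start a j = A j" for j
    by (induction j) (use A_less in \<open>auto simp: a_def less_imp_le simp del: A(2)\<close>)
  have no_change: "d i = d (Suc i)" if "A j \<le> i" "i < e j" for i j
  proof (rule ccontr)
    assume "d i \<noteq> d (Suc i)"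
    then obtain k where k: "i = e k" using range by blast
    hence "k < j" using that(2) strict_mono_less[OF mono] by blast
    moreover have "j \<le> k"
    proof (cases j)
      case (Suc l)
      hence "e l < e k" using that(1) k by simp
      hence "l < k" using strict_mono_less[OF mono] by blast
      thus ?thesis using Suc by simp
    qed simp
    ultimately show False by simp
  qed
  have const: "d i = d (A j)" if "A j \<le> i" "i \<le> e j" for i j
    using that
  proof (induction i rule: dec_induct)
    case (step n)
    thus ?case using no_change[of j n] by simp
  qed simp
  have parity: "d (A j) = even j" for j
  proof (induction j)
    case 0
    thus ?case using d0 by simp
  next
    case (Suc j)
    have "A j \<le> e j" using A_less[of j] by simp
    hence "d (e j) = even j" using const[of j "e j"] Suc by simp
    moreover have "d (e j) \<noteq> d (Suc (e j))" using range by blast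
    ultimately show ?case by simp
  qed
  have "block_digit a i = of_bool (d i)" for i
  proof -
    have "\<exists>j. A j \<le> i \<and> i < A (Suc j)"
    proof -
      define j where "j = (LEAST j. i < A (Suc j))"
      have "i \<le> e i" using strict_mono_imp_increasing[OF mono] by blast
      hence ex: "i < A (Suc i)" by simp
      have 1: "i < A (Suc j)" unfolding j_def by (rule LeastI[of _ i]) (rule ex)
      have "A j \<le> i"
      proof (cases j)
        case (Suc k)
        hence "\<not> i < A (Suc k)" unfolding j_def by (intro not_less_Least) simp
        thus ?thesis using Suc by simp
      qed simp
      with 1 show ?thesis by blast
    qed
    then obtain j where j: "A j \<le> i" "i < A (Suc j)" by blast
    hence "block_digit a i = of_bool (even j)"
      by (intro block_digit_eq[OF a]) (simp_all only: start)
    also have "even j = d i" using const[of j i] parity[of j] j by simp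
    finally show ?thesis .
  qed
  with a show ?thesis by blast
qed

lemma changes_map_upt: "changes (map d [0..<Suc m]) = card {i \<in> {..<m}. d i \<noteq> d (Suc i)}"
proof (induction m)
  case (Suc m)
  have "map d [0..<Suc (Suc m)] = map d [0..<Suc m] @ [d (Suc m)]" by simp
  hence "changes (map d [0..<Suc (Suc m)])
      = changes (map d [0..<Suc m]) + (if d m \<noteq> d (Suc m) then 1 else 0)"
    using changes_append[of "map d [0..<Suc m]" "[d (Suc m)]"] by simp
  moreover have "{i \<in> {..<Suc m}. d i \<noteq> d (Suc i)} =
      (if d m \<noteq> d (Suc m) then insert m {i \<in> {..<m}. d i \<noteq> d (Suc i)} else {i \<in> {..<m}. d i \<noteq> d (Suc i)})"
    by (auto simp: less_Suc_eq)
  ultimately show ?case using Suc by simp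
qed simp

text \<open>
  With finitely many changes, their number among the first \<open>m\<close> digits would be \<open>o(m)\<close>.
\<close>
lemma infinite_changes:
  assumes t: "t \<ge> 0" and lim: "(\<lambda>m. real (changes (word m t)) / m) \<longlonglongrightarrow> 1 / 2"
  shows "infinite {i. digit t i \<noteq> digit t (Suc i)}" (is "infinite ?C")
proof
  assume fin: "finite ?C"
  have "changes (word m t) \<le> card ?C" for m
  proof (cases m)
    case (Suc k)
    have "card {i \<in> {..<k}. digit t i \<noteq> digit t (Suc i)} \<le> card ?C"
      using fin by (intro card_mono) auto
    thus ?thesis unfolding word_eq_map_digit[OF t] Suc changes_map_upt .
  qed (simp add: word_def)
  hence le: "\<forall>\<^sub>F m in sequentially. real (changes (word m t)) / m \<le> real (card ?C) / m"
    by (intro always_eventually allI divide_right_mono of_nat_mono) simp_all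
  have "(\<lambda>m. real (card ?C) / real m) \<longlonglongrightarrow> 0"
    by (rule tendsto_divide_0[OF tendsto_const filterlim_real_at_infinity_sequentially])
  hence "1 / 2 \<le> (0 :: real)" by (rule tendsto_le[OF sequentially_bot _ lim le])
  thus False by simp
qed

text \<open>
  Evaluate both limits at the ends \<open>A s\<close> of the blocks.  There the word consists of \<open>s\<close> complete blocks and has \<open>s - 1\<close>
  changes, so the quotient of the two limits is the limit of \<open>log norm1 / (s - 1)\<close>.  The norm is
  the denominator of the convergent up to a factor 4, which disappears after division by \<open>s\<close>.
\<close>
lemma log_denominator_limit:
  assumes exp: "block_expansion t a" and t: "t \<in> {0..<1}"
    and lim_norm: "(\<lambda>m. ln (norm1 (word m t)) / m) \<longlonglongrightarrow> \<alpha> * ln 2"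
    and lim_changes: "(\<lambda>m. real (changes (word m t)) / m) \<longlonglongrightarrow> 1 / 2"
  shows "(\<lambda>s. ln (real_of_int (convergent_denom a s)) / (real s * ln 4)) \<longlonglongrightarrow> \<alpha>"
proof -
  have a: "\<forall>j. a j \<ge> 1" using exp by (simp add: block_expansion_def)
  define A where "A = block_start a"
  define f where "f s = ln (norm1 (word (A s) t))" for s
  define q where "q s = fst (continuants (map a [0..<s]))" for s
  have mono: "strict_mono A" unfolding A_def by (rule block_start_strict_mono[OF a])
  have top: "filterlim A at_top sequentially" by (rule filterlim_subseq[OF mono])
  have w: "word (A s) t = blocks True (map a [0..<s])" for s
    using t by (simp add: word_eq_map_digit block_expansion_digit[OF exp] A_def map_block_digit[OF a])
  have changes: "real (changes (word (A s) t)) = real s - 1" if "s \<ge> 1" for s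
  proof -
    have "Suc (changes (word (A s) t)) = length (map a [0..<s])"
      unfolding w using a that by (intro changes_blocks) auto
    hence "Suc (changes (word (A s) t)) = s" by simp
    thus ?thesis by linarith
  qed
  have A_pos: "A s > 0" if "s \<ge> 1" for s
    using strict_monoD[OF mono, of 0 s] that by simp
  have "(\<lambda>s. real (changes (word (A s) t)) / A s) \<longlonglongrightarrow> 1 / 2"
    by (rule filterlim_compose[OF lim_changes top])
  moreover have "(\<lambda>s. f s / A s) \<longlonglongrightarrow> \<alpha> * ln 2"
    unfolding f_def by (rule filterlim_compose[OF lim_norm top])
  ultimately have "(\<lambda>s. (f s / A s) / (real (changes (word (A s) t)) / A s)) \<longlonglongrightarrow> \<alpha> * ln 2 / (1 / 2)"
    using tendsto_divide[of "\<lambda>s. f s / A s" "\<alpha> * ln 2" sequentially "\<lambda>s. real (changes (word (A s) t)) / A s" "1 / 2"]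
    by (simp only: divide_eq_0_iff) simp
  moreover have "(\<lambda>s. (real s - 1) / real s) \<longlonglongrightarrow> 1" by real_asymp
  ultimately have "(\<lambda>s. (f s / A s) / (real (changes (word (A s) t)) / A s) * ((real s - 1) / real s))
      \<longlonglongrightarrow> \<alpha> * ln 2 / (1 / 2) * 1"
    by (rule tendsto_mult)
  moreover have "\<forall>\<^sub>F s in sequentially.
      (f s / A s) / (real (changes (word (A s) t)) / A s) * ((real s - 1) / real s) = f s / s"
    using eventually_gt_at_top[of 1]
  proof eventually_elim
    case (elim s)
    thus ?case using changes[of s] A_pos[of s] by simp
  qed
  ultimately have "(\<lambda>s. f s / s) \<longlonglongrightarrow> \<alpha> * ln 2 / (1 / 2) * 1"
    by (rule Lim_transform_eventually)
  moreover have "ln 4 = 2 * ln (2 :: real)" using ln_realpow[of 2 2] by simp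
  ultimately have lim_f: "(\<lambda>s. f s / s) \<longlonglongrightarrow> \<alpha> * ln 4" by (simp add: mult_ac)
  have q: "0 < q s" "q s \<le> norm1 (word (A s) t)" "norm1 (word (A s) t) \<le> 4 * q s" for s
    using norm1_blocks_bounds[of "map a [0..<s]" True] continuants_cfrac[of "map a [0..<s]"] a
    unfolding w q_def by auto
  have lower: "(f s - ln 4) / s \<le> ln (q s) / s" for s
  proof -
    have "real (norm1 (word (A s) t)) \<le> real (4 * q s)" using q(3) by (rule of_nat_mono)
    hence "f s \<le> ln (4 * real (q s))"
      unfolding f_def using q(1)[of s] norm1_pos[of "word (A s) t"] by (subst ln_le_cancel_iff) auto
    also have "\<dots> = ln 4 + ln (q s)" using q(1)[of s] by (subst ln_mult_pos) auto
    finally show ?thesis by (intro divide_right_mono) auto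
  qed
  have upper: "ln (q s) / s \<le> f s / s" for s
    unfolding f_def using q(1,2)[of s] by (intro divide_right_mono) auto
  have "(\<lambda>s. f s / s - ln 4 / real s) \<longlonglongrightarrow> \<alpha> * ln 4 - 0"
    by (intro tendsto_diff lim_f) real_asymp
  hence "(\<lambda>s. (f s - ln 4) / s) \<longlonglongrightarrow> \<alpha> * ln 4" by (simp add: diff_divide_distrib)
  hence "(\<lambda>s. ln (q s) / s) \<longlonglongrightarrow> \<alpha> * ln 4"
    by (rule tendsto_sandwich[OF _ _ _ lim_f, rotated 2]) (simp_all add: lower upper)
  hence "(\<lambda>s. ln (q s) / s / ln 4) \<longlonglongrightarrow> \<alpha> * ln 4 / ln 4"
    by (rule tendsto_divide[OF _ tendsto_const]) simp
  thus ?thesis by (simp add: convergent_denom_eq_continuant[OF a] q_def)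
qed

theorem proposition30:
  fixes \<alpha>\<^sub>0 :: real and S :: "nat set"
  assumes "\<alpha>\<^sub>0 > 0"
    and "has_natural_density S 1"
    and "(\<lambda>k. ln (real (hyperbinary_count (enumerate S k))) / ln (real (enumerate S k)))
           \<longlonglongrightarrow> \<alpha>\<^sub>0"
  shows "AE t\<in>{1/2..<1} in lebesgue.
           (\<exists>!a. block_expansion t a) \<and>
           (\<forall>a. block_expansion t a \<longrightarrow>
              (\<lambda>s. ln (real_of_int (convergent_denom a s)) / (real s * ln 4)) \<longlonglongrightarrow> \<alpha>\<^sub>0)"
proof (rule AE_completion)
  have "(\<lambda>L. mean_value (\<lambda>w. ln (norm1 w)) L / L) \<longlonglongrightarrow> \<alpha>\<^sub>0 * ln 2"
    by (rule mean_log_norm_tendsto[OF less_imp_le[OF assms(1)] assms(2,3)])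
  hence "AE t in lborel. t \<in> {0..<1} \<longrightarrow> (\<lambda>m. ln (norm1 (word m t)) / m) \<longlonglongrightarrow> \<alpha>\<^sub>0 * ln 2"
    by (rule log_norm.AE_tendsto_mean)
  moreover have "AE t in lborel. t \<in> {0..<1} \<longrightarrow> (\<lambda>m. real (changes (word m t)) / m) \<longlonglongrightarrow> 1 / 2"
    by (rule change_count.AE_tendsto_mean[OF mean_changes_tendsto])
  ultimately show "AE t\<in>{1/2..<1} in lborel.
           (\<exists>!a. block_expansion t a) \<and>
           (\<forall>a. block_expansion t a \<longrightarrow>
              (\<lambda>s. ln (real_of_int (convergent_denom a s)) / (real s * ln 4)) \<longlonglongrightarrow> \<alpha>\<^sub>0)"
  proof eventually_elim
    case (elim t)
    show ?case
    proof (intro impI conjI)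
      assume half: "t \<in> {1/2..<1}"
      hence t: "t \<in> {0..<1}" by auto
      have lims: "(\<lambda>m. ln (norm1 (word m t)) / m) \<longlonglongrightarrow> \<alpha>\<^sub>0 * ln 2"
        "(\<lambda>m. real (changes (word m t)) / m) \<longlonglongrightarrow> 1 / 2"
        using elim t by blast+
      have "prefix 2 (Suc 0) t = 1"
        using half by (subst prefix_eq_iff) auto
      hence d0: "digit t 0" by (simp add: digit_def)
      have "infinite {i. digit t i \<noteq> digit t (Suc i)}"
        using infinite_changes[OF _ lims(2)] t by simp
      from block_lengths_exist[OF d0 this] obtain a
        where a: "\<forall>j. a j \<ge> 1" "\<And>i. block_digit a i = of_bool (digit t i)" by blast
      have "block_expansion t a"
        using digit_sums[OF t] a by (simp add: block_expansion_def)
      moreover have "b = c" if "block_expansion t b" "block_expansion t c" for b c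
      proof (rule block_lengths_unique)
        show "block_digit b i = block_digit c i" for i
          using block_expansion_digit[OF that(1)] block_expansion_digit[OF that(2)]
          by (metis block_digit_01)
      qed (use that in \<open>auto simp: block_expansion_def\<close>)
      ultimately show "\<exists>!a. block_expansion t a" by blast
      show "\<forall>a. block_expansion t a \<longrightarrow>
              (\<lambda>s. ln (real_of_int (convergent_denom a s)) / (real s * ln 4)) \<longlonglongrightarrow> \<alpha>\<^sub>0"
        using log_denominator_limit[OF _ t lims] by blast
    qed
  qed
qed

end
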